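(* Let $D$ be a connected Postnikov diagram of type $(k,n)$, let $\mu$ be a perfect matching of the associated quiver $Q(D)$ with corresponding $A_D$-module $N_\mu$, and let $e$ be the boundary idempotent of $A_D$. Then \[\rho(eN_\mu)=M_{\partial\mu},\] where $\rho\colon\mathrm{CM}(B)\to\mathrm{CM}(C)$ denotes restriction along the canonical map $\varepsilon\colon C\to B=eA_De$.
   Context: **Postnikov diagrams.** Fix a disc with $n$ marked points on its boundary, labelled clockwise by $\mathcal C_1=\{1,\dots,n\}$ (indices modulo $n$); let $\mathcal C_0$ be the set of $n$ boundary intervals between consecutive marked points. A Postnikov diagram $D$ is a set of $n$ oriented curves (strands) in the disc connecting marked points, each marked point being the start of exactly one strand and the end of exactly one strand, such that: (a1) only two strands can cross at a given point and all crossings are transverse; (a2) there are finitely many crossings; (a3) along a given strand, the other strands crossing it alternate between crossing left to right and right to left; (b1) a strand does not cross itself; (b2) if two strands cross at distinct points $U,V$, one is oriented from $U$ to $V$ and the other from $V$ to $U$. For (a3),(b2), two strands meeting at a marked point count as crossing there. $D$ is connected if the union of its strands is connected. **Bipartite graph, type, quiver.** Each region (component of the complement of the strands) is alternating (strands around its boundary alternate in orientation) or oriented (strands all clockwise or all anticlockwise around it). The bipartite graph $\Gamma(D)$ has a white (resp. black) node for each clockwise (resp. anticlockwise) region, an edge for each crossing point where two oriented regions meet, and for each $i\in\mathcal C_1$ a half-edge joining marked point $i$ to the node whose region meets it. The type of $D$ is $(k,n)$, where $k=\#\{\text{white nodes}\}-\#\{\text{black nodes}\}+\#\{\text{half-edges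 incident with a black node}\}$; we assume $1\le k<n$. The quiver with faces $Q(D)=(Q_0,Q_1,Q_2)$ has vertices the alternating regions; one arrow for each crossing in the interior (internal arrows) and for each marked point (boundary arrows, labelled by $\mathcal C_1$), joining the two alternating regions meeting there, oriented consistently with the strands, so that the black (anticlockwise) region is on its left and/or the white (clockwise) region is on its right; faces are the oriented regions, with boundary $\partial F$ the cycle of arrows at the corners. A face is black if anticlockwise, white if clockwise. Each internal arrow lies in one black and one white face; each boundary arrow lies in one face, and is called clockwise if that face is white, anticlockwise if it is black. Boundary vertices (regions with an edge on the boundary of the disc) are identified with $\mathcal C_0$. **Algebras.** Paths are composed right to left, modules are left modules, $e_j$ are vertex idempotents. For an internal arrow $\alpha$ in black/white faces $F^{\pm}$ write $\partial F^\pm=\alpha p^\pm_\alpha$. The dimer algebra $A_D$ is the quotient of the complete path algebra of $Q(D)$ over $\mathbb C$ by the closure of the ideal generated by $p^+_\alpha-p^-_\alpha$, $\alpha$ internal. All cycles at a vertex $i$ bounding a face give the same element $t_i\in A_D$; $t=\sum_i t_i$ is central, so $A_D$ is an algebra over $Z=\mathbb C[[t]]$. Put $e=\sum_{i\in\mathcal C_0}e_i$, $B=eA_De$. $C=C_{k,n}$: take the quiver with vertex set $\mathcal C_0$ and, for each $i\in\mathcal C_1$, arrows $x_i$ (clockwise) and $y_i$ (anticlockwise) between the two intervals adjacent to marked point $i$; with $x=\sum x_i$, $y=\sum y_i$, $C$ is the quotient of the complete path algebra by the closed ideal generated by $xy-yx$ and $y^k-x^{n-k}$; it is a $Z$-algebra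 with $t=xy$. For a $k$-subset $I\subset\mathcal C_1$, the $C$-module $M_I$ has $e_jM_I=Z$ for all $j\in\mathcal C_0$, $x_i$ acting as $t$ if $i\in I$ and as $1$ otherwise, $y_i$ acting as $1$ if $i\in I$ and as $t$ otherwise. The canonical algebra map $\varepsilon\colon C\to B$ fixes the $e_j$ and sends $x_i\mapsto\alpha_i$, $y_i\mapsto\beta_i$: if the boundary arrow labelled $i$ is clockwise, $\alpha_i$ is this arrow and $\beta_i$ the path completing it to the boundary of its face; if anticlockwise, $\beta_i$ is this arrow and $\alpha_i$ the path completing it. $\mathrm{CM}(B),\mathrm{CM}(C)$ denote the categories of modules free and finitely generated over $Z$. **Perfect matchings.** A perfect matching of $Q$ is a subset $\mu\subset Q_1$ such that the boundary of each face contains exactly one arrow of $\mu$. $N_\mu$ is the $A_D$-module with $e_iN_\mu=Z$ for all $i\in Q_0$, an arrow $\alpha$ acting as $t$ if $\alpha\in\mu$ and as the identity otherwise. The boundary value $\partial\mu\subset\mathcal C_1$ is the set of $i$ such that the boundary arrow labelled $i$ is clockwise and in $\mu$, or is anticlockwise and not in $\mu$; it is a $k$-subset. *)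

theory Defs
  imports
    "HOL-Analysis.Analysis"
    "HOL-Algebra.Algebra"
    "HOL-Computational_Algebra.Formal_Power_Series"
    "Graph_Theory.Arc_Walk"
begin

section \<open>Postnikov diagrams\<close>

text \<open>
  The disc is the closed unit disc in the complex plane.  Marked points, boundary intervals and
  strands are indexed by \<open>0, \<dots>, n - 1\<close>; \<open>strand D i\<close> is parametrised by the unit interval and
  starts at marked point \<open>i\<close>.
\<close>

record diagram =
  npts :: nat
  strand :: "nat \<Rightarrow> real \<Rightarrow> complex"

definition mark :: "diagram \<Rightarrow> nat \<Rightarrow> complex" where
  "mark D i = cis (- 2 * pi * real i / real (npts D))"

text \<open>The boundary interval from marked point \<open>j\<close> clockwise to marked point \<open>j + 1\<close>.\<close>

definition interval :: "diagram \<Rightarrow> nat \<Rightarrow> complex set" where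
  "interval D j = {cis (- 2 * pi * (real j + u) / real (npts D)) | u. 0 < u \<and> u < 1}"

definition vel :: "diagram \<Rightarrow> nat \<Rightarrow> real \<Rightarrow> complex" where
  "vel D i s = vector_derivative (strand D i) (at s within {0..1})"

definition strand_union :: "diagram \<Rightarrow> complex set" where
  "strand_union D = (\<Union>i<npts D. strand D i ` {0..1})"

text \<open>
  The strand branches through a point.  A marked point has two branches as well: the
  starting end of one strand and the final end of one strand.
\<close>

definition branches :: "diagram \<Rightarrow> complex \<Rightarrow> (nat \<times> real) set" where
  "branches D p = {(i, s). i < npts D \<and> s \<in> {0..1} \<and> strand D i s = p}"

definition crossings :: "diagram \<Rightarrow> complex set" where
  "crossings D = {p \<in> ball 0 1. \<exists>i s j t. i \<noteq> j \<and> (i, s) \<in> branches D p \<and> (j, t) \<in> branches D p}"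

text \<open>Positive iff \<open>w\<close> points to the left of \<open>v\<close>.\<close>

definition wedge :: "complex \<Rightarrow> complex \<Rightarrow> real" where
  "wedge v w = Im (cnj v * w)"

text \<open>The parameters at which strand \<open>i\<close> meets another branch (at a crossing or a marked point).\<close>

definition meeting_params :: "diagram \<Rightarrow> nat \<Rightarrow> real set" where
  "meeting_params D i = {s \<in> {0..1}. strand D i s \<in> crossings D \<union> mark D ` {..<npts D}}"

definition consecutive :: "diagram \<Rightarrow> nat \<Rightarrow> real \<Rightarrow> real \<Rightarrow> bool" where
  "consecutive D i s s' \<longleftrightarrow>
     s \<in> meeting_params D i \<and> s' \<in> meeting_params D i \<and> s < s' \<and>
     {s<..<s'} \<inter> meeting_params D i = {}"

definition crossed_right_to_left :: "diagram \<Rightarrow> nat \<Rightarrow> real \<Rightarrow> bool" where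
  "crossed_right_to_left D i s \<longleftrightarrow>
     (\<exists>(j, t) \<in> branches D (strand D i s) - {(i, s)}. wedge (vel D i s) (vel D j t) > 0)"

text \<open>
  Strands are regular C1 curves, so that transversality and the side from which a strand is
  crossed can be read off from velocities; at a marked point, the two strand ends are treated
  as branches of a crossing there.
\<close>

definition postnikov_diagram :: "diagram \<Rightarrow> bool" where
  "postnikov_diagram D \<longleftrightarrow>
     (let n = npts D in
      (\<forall>i<n. (\<forall>s\<in>{0..1}. strand D i differentiable (at s within {0..1}) \<and> vel D i s \<noteq> 0) \<and>
             continuous_on {0..1} (vel D i) \<and>
             strand D i 0 = mark D i \<and>
             strand D i ` {0<..<1} \<subseteq> ball 0 1) \<and>
      bij_betw (\<lambda>i. strand D i 1) {..<n} (mark D ` {..<n}) \<and>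
      \<comment> \<open>at most two strands at a point; all crossings transverse\<close>
      (\<forall>p\<in>ball 0 1. card {i. i < n \<and> p \<in> strand D i ` {0..1}} \<le> 2) \<and>
      (\<forall>p. \<forall>(i, s) \<in> branches D p. \<forall>(j, t) \<in> branches D p.
          (i, s) \<noteq> (j, t) \<longrightarrow> wedge (vel D i s) (vel D j t) \<noteq> 0) \<and>
      \<comment> \<open>finitely many crossings\<close>
      finite (crossings D) \<and>
      \<comment> \<open>the crossings along a strand alternate in direction\<close>
      (\<forall>i<n. \<forall>s s'. consecutive D i s s' \<longrightarrow>
          crossed_right_to_left D i s \<noteq> crossed_right_to_left D i s') \<and>
      \<comment> \<open>no self-crossings\<close>
      (\<forall>i<n. inj_on (strand D i) {0<..<1}) \<and>
      \<comment> \<open>two strands crossing twice are oppositely oriented between the crossings\<close>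
      (\<forall>i<n. \<forall>j<n. \<forall>s\<in>{0..1}. \<forall>s'\<in>{0..1}. \<forall>t\<in>{0..1}. \<forall>t'\<in>{0..1}.
          i \<noteq> j \<and> strand D i s = strand D j t \<and> strand D i s' = strand D j t' \<and> s < s'
          \<longrightarrow> t' < t))"

definition connected_diagram :: "diagram \<Rightarrow> bool" where
  "connected_diagram D \<longleftrightarrow> connected (strand_union D)"


section \<open>Regions and type\<close>

definition regions :: "diagram \<Rightarrow> complex set set" where
  "regions D = components (cball 0 1 - strand_union D)"

text \<open>\<open>R\<close> contains the points close to \<open>p\<close> on the ray from \<open>p\<close> in direction \<open>w\<close>.\<close>

definition contains_germ :: "complex \<Rightarrow> complex \<Rightarrow> complex set \<Rightarrow> bool" where
  "contains_germ p w R \<longleftrightarrow> (\<forall>\<^sub>F e in at_right 0. p + complex_of_real e * w \<in> R)"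

definition on_left :: "diagram \<Rightarrow> nat \<Rightarrow> real \<Rightarrow> complex set \<Rightarrow> bool" where
  "on_left D i s R \<longleftrightarrow> contains_germ (strand D i s) (\<i> * vel D i s) R"

definition on_right :: "diagram \<Rightarrow> nat \<Rightarrow> real \<Rightarrow> complex set \<Rightarrow> bool" where
  "on_right D i s R \<longleftrightarrow> contains_germ (strand D i s) (- \<i> * vel D i s) R"

text \<open>
  A clockwise region lies to the right of every strand segment on its boundary, an anticlockwise
  region to the left.  Oriented regions meet the boundary of the disc at most in
  marked points, which are not points of the region itself.
\<close>

definition clockwise_region :: "diagram \<Rightarrow> complex set \<Rightarrow> bool" where
  "clockwise_region D R \<longleftrightarrow> R \<in> regions D \<and> R \<inter> sphere 0 1 = {} \<and>
     (\<forall>i<npts D. \<forall>s \<in> {0..1} - meeting_params D i. \<not> on_left D i s R)"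

definition anticlockwise_region :: "diagram \<Rightarrow> complex set \<Rightarrow> bool" where
  "anticlockwise_region D R \<longleftrightarrow> R \<in> regions D \<and> R \<inter> sphere 0 1 = {} \<and>
     (\<forall>i<npts D. \<forall>s \<in> {0..1} - meeting_params D i. \<not> on_right D i s R)"

definition faces :: "diagram \<Rightarrow> complex set set" where
  "faces D = {F. clockwise_region D F \<or> anticlockwise_region D F}"

text \<open>
  For branches with velocities \<open>a\<close>, \<open>b\<close> at \<open>p\<close>, the four sectors at \<open>p\<close> contain the directions
  \<open>a + b\<close> (both strands outgoing along the sector), \<open>- a - b\<close> (both incoming), and \<open>a - b\<close>, \<open>b - a\<close>
  (one outgoing and one incoming).  In an alternating region, the two strands at
  each corner are both outgoing or both incoming.
\<close>

definition alternating_region :: "diagram \<Rightarrow> complex set \<Rightarrow> bool" where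
  "alternating_region D R \<longleftrightarrow> R \<in> regions D \<and>
     (\<forall>p. \<forall>(i, s) \<in> branches D p. \<forall>(j, t) \<in> branches D p.
        (i, s) \<noteq> (j, t) \<longrightarrow> \<not> contains_germ p (vel D i s - vel D j t) R)"

definition interval_region :: "diagram \<Rightarrow> nat \<Rightarrow> complex set" where
  "interval_region D j = (THE R. R \<in> regions D \<and> interval D j \<subseteq> R)"

definition sector_region :: "diagram \<Rightarrow> complex \<Rightarrow> complex \<Rightarrow> complex set" where
  "sector_region D p w = (THE R. R \<in> regions D \<and> contains_germ p w R)"

text \<open>The white nodes of the bipartite graph are the clockwise regions, the black nodes the
  anticlockwise ones, and the half-edge at a marked point ends at the oriented region meeting it.\<close>

definition has_type :: "diagram \<Rightarrow> nat \<Rightarrow> nat \<Rightarrow> bool" where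
  "has_type D k n \<longleftrightarrow> npts D = n \<and>
     int k = int (card {R. clockwise_region D R}) - int (card {R. anticlockwise_region D R})
           + int (card {i. i < n \<and> (\<exists>R. anticlockwise_region D R \<and> mark D i \<in> closure R)})"


section \<open>The quiver with faces\<close>

datatype arrow = Crossing complex | Boundary nat

definition dimer_arrows :: "diagram \<Rightarrow> arrow set" where
  "dimer_arrows D = Crossing ` crossings D \<union> Boundary ` {..<npts D}"

fun arrow_pos :: "diagram \<Rightarrow> arrow \<Rightarrow> complex" where
  "arrow_pos D (Crossing p) = p"
| "arrow_pos D (Boundary i) = mark D i"

text \<open>The arrows at the corners of an oriented region.\<close>

definition corners :: "diagram \<Rightarrow> complex set \<Rightarrow> arrow set" where
  "corners D F = {\<alpha> \<in> dimer_arrows D. arrow_pos D \<alpha> \<in> closure F}"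

definition clockwise_arrow :: "diagram \<Rightarrow> nat \<Rightarrow> bool" where
  "clockwise_arrow D i \<longleftrightarrow> (\<exists>F. clockwise_region D F \<and> Boundary i \<in> corners D F)"

text \<open>
  An internal arrow points in the direction \<open>a + b\<close>, where \<open>a\<close>, \<open>b\<close> are the velocities of the two
  strands; it thus has the anticlockwise region at the crossing on its left and the clockwise one
  on its right.  The boundary arrow \<open>i\<close> joins the intervals \<open>i - 1\<close> and \<open>i\<close> adjacent to marked
  point \<open>i\<close>, in the direction determined by the colour of its only face.
\<close>

definition flow_direction :: "diagram \<Rightarrow> complex \<Rightarrow> complex" where
  "flow_direction D p = (\<Sum>(i, s) \<in> branches D p. vel D i s)"

definition interval_before :: "nat \<Rightarrow> nat \<Rightarrow> nat" where
  "interval_before n i = (i + n - 1) mod n"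

fun arrow_tail :: "diagram \<Rightarrow> arrow \<Rightarrow> complex set" where
  "arrow_tail D (Crossing p) = sector_region D p (- flow_direction D p)"
| "arrow_tail D (Boundary i) =
     interval_region D (if clockwise_arrow D i then interval_before (npts D) i else i)"

fun arrow_head :: "diagram \<Rightarrow> arrow \<Rightarrow> complex set" where
  "arrow_head D (Crossing p) = sector_region D p (flow_direction D p)"
| "arrow_head D (Boundary i) =
     interval_region D (if clockwise_arrow D i then i else interval_before (npts D) i)"

definition dimer_quiver :: "diagram \<Rightarrow> (complex set, arrow) pre_digraph" where
  "dimer_quiver D =
     \<lparr> verts = {R. alternating_region D R}, arcs = dimer_arrows D,
       tail = arrow_tail D, head = arrow_head D \<rparr>"

text \<open>The strand segment starting at the corner \<open>\<alpha>\<close> on the boundary of the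
  oriented region \<open>F\<close> leads to the corner \<open>\<beta>\<close>.\<close>

definition next_corner :: "diagram \<Rightarrow> complex set \<Rightarrow> arrow \<Rightarrow> arrow \<Rightarrow> bool" where
  "next_corner D F \<alpha> \<beta> \<longleftrightarrow>
     (\<exists>i<npts D. \<exists>s s'. consecutive D i s s' \<and>
        strand D i s = arrow_pos D \<alpha> \<and> strand D i s' = arrow_pos D \<beta> \<and>
        (\<forall>u. s < u \<and> u < s' \<longrightarrow> on_left D i u F \<or> on_right D i u F))"

text \<open>
  The boundary cycle of a face \<open>F\<close>, as the list of arrows in the order in which they are
  traversed from a chosen starting point.  Hence \<open>\<partial>F = \<alpha> p\<close> holds for the path \<open>p\<close> with arrows
  \<open>as\<close> iff \<open>boundary_cycle D F (\<alpha> # as)\<close>.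
\<close>

definition boundary_cycle :: "diagram \<Rightarrow> complex set \<Rightarrow> arrow list \<Rightarrow> bool" where
  "boundary_cycle D F as \<longleftrightarrow> F \<in> faces D \<and> as \<noteq> [] \<and> distinct as \<and> set as = corners D F \<and>
     (\<forall>m<length as. next_corner D F (as ! m) (as ! (Suc m mod length as))) \<and>
     pre_digraph.awalk (dimer_quiver D) (arrow_tail D (hd as)) as (arrow_tail D (hd as))"


section \<open>Complete path algebras\<close>

text \<open>
  A path is a start vertex together with the list of arrows in the order of traversal; the product
  \<open>f g\<close> of paths is \<open>g\<close> followed by \<open>f\<close>.  Elements of the complete path algebra are arbitrary
  families of coefficients on paths.
\<close>

type_synonym ('v, 'a) path_elt = "'v \<times> 'a list \<Rightarrow> complex"

definition paths :: "('v, 'a) pre_digraph \<Rightarrow> ('v \<times> 'a list) set" where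
  "paths G = {(u, p). \<exists>v. pre_digraph.awalk G u p v}"

definition path_algebra :: "('v, 'a) pre_digraph \<Rightarrow> ('v, 'a) path_elt ring" where
  "path_algebra G =
     \<lparr> carrier = {f. \<forall>\<pi>. \<pi> \<notin> paths G \<longrightarrow> f \<pi> = 0},
       monoid.mult = (\<lambda>f g (u, p). \<Sum>m\<le>length p.
          g (u, take m p) * f (pre_digraph.awlast G u (take m p), drop m p)),
       one = (\<lambda>(u, p). if u \<in> verts G \<and> p = [] then 1 else 0),
       ring.zero = (\<lambda>_. 0),
       ring.add = (\<lambda>f g \<pi>. f \<pi> + g \<pi>) \<rparr>"

definition path_elem :: "'v \<Rightarrow> 'a list \<Rightarrow> ('v, 'a) path_elt" where
  "path_elem u p = (\<lambda>\<pi>. if \<pi> = (u, p) then 1 else 0)"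

definition arrow_elem :: "('v, 'a) pre_digraph \<Rightarrow> 'a \<Rightarrow> ('v, 'a) path_elt" where
  "arrow_elem G a = path_elem (tail G a) [a]"

definition scalar_elem :: "('v, 'a) pre_digraph \<Rightarrow> complex \<Rightarrow> ('v, 'a) path_elt" where
  "scalar_elem G c = (\<lambda>(u, p). if u \<in> verts G \<and> p = [] then c else 0)"

text \<open>The closure, in the topology given by path length, of the two-sided ideal generated by \<open>S\<close>.\<close>

definition closed_ideal :: "('v, 'a) pre_digraph \<Rightarrow> ('v, 'a) path_elt set \<Rightarrow> ('v, 'a) path_elt set" where
  "closed_ideal G S =
     {f \<in> carrier (path_algebra G).
        \<forall>l. \<exists>g \<in> Idl\<^bsub>path_algebra G\<^esub> S. \<forall>(u, p) \<in> paths G. length p < l \<longrightarrow> f (u, p) = g (u, p)}"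

definition path_quotient :: "('v, 'a) pre_digraph \<Rightarrow> ('v, 'a) path_elt set \<Rightarrow> ('v, 'a) path_elt set ring" where
  "path_quotient G S = path_algebra G Quot closed_ideal G S"

definition path_class ::
  "('v, 'a) pre_digraph \<Rightarrow> ('v, 'a) path_elt set \<Rightarrow> ('v, 'a) path_elt \<Rightarrow> ('v, 'a) path_elt set" where
  "path_class G S f = closed_ideal G S +>\<^bsub>path_algebra G\<^esub> f"

text \<open>The element \<open>f(w)\<close> for a power series \<open>f\<close> and an element \<open>w\<close> without constant term.\<close>

definition power_series_elem ::
  "('v, 'a) pre_digraph \<Rightarrow> ('v, 'a) path_elt \<Rightarrow> complex fps \<Rightarrow> ('v, 'a) path_elt" where
  "power_series_elem G w f =
     (\<lambda>\<pi>. \<Sum>m\<le>length (snd \<pi>). fps_nth f m * (w [^]\<^bsub>path_algebra G\<^esub> m) \<pi>)"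


section \<open>Modules over noncommutative rings\<close>

text \<open>
  Modules are instances of the library record, whose multiplication and
  unit fields are irrelevant; the library locale \<open>module\<close> requires a commutative ring.
\<close>

locale left_module = R?: ring R + M?: abelian_group M
  for R :: "('r, 'x) ring_scheme" and M :: "('r, 'm, 'y) module_scheme" +
  assumes smult_closed:
      "\<lbrakk>a \<in> carrier R; x \<in> carrier M\<rbrakk> \<Longrightarrow> a \<odot>\<^bsub>M\<^esub> x \<in> carrier M"
    and smult_l_distr:
      "\<lbrakk>a \<in> carrier R; b \<in> carrier R; x \<in> carrier M\<rbrakk> \<Longrightarrow>
         (a \<oplus>\<^bsub>R\<^esub> b) \<odot>\<^bsub>M\<^esub> x = a \<odot>\<^bsub>M\<^esub> x \<oplus>\<^bsub>M\<^esub> b \<odot>\<^bsub>M\<^esub> x"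
    and smult_r_distr:
      "\<lbrakk>a \<in> carrier R; x \<in> carrier M; y \<in> carrier M\<rbrakk> \<Longrightarrow>
         a \<odot>\<^bsub>M\<^esub> (x \<oplus>\<^bsub>M\<^esub> y) = a \<odot>\<^bsub>M\<^esub> x \<oplus>\<^bsub>M\<^esub> a \<odot>\<^bsub>M\<^esub> y"
    and smult_assoc:
      "\<lbrakk>a \<in> carrier R; b \<in> carrier R; x \<in> carrier M\<rbrakk> \<Longrightarrow>
         (a \<otimes>\<^bsub>R\<^esub> b) \<odot>\<^bsub>M\<^esub> x = a \<odot>\<^bsub>M\<^esub> (b \<odot>\<^bsub>M\<^esub> x)"
    and smult_one:
      "x \<in> carrier M \<Longrightarrow> \<one>\<^bsub>R\<^esub> \<odot>\<^bsub>M\<^esub> x = x"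

definition left_module_iso ::
  "('r, 'x) ring_scheme \<Rightarrow> ('r, 'm, 'y) module_scheme \<Rightarrow> ('r, 'l, 'z) module_scheme \<Rightarrow> ('m \<Rightarrow> 'l) \<Rightarrow> bool" where
  "left_module_iso R M L \<phi> \<longleftrightarrow>
     left_module R M \<and> left_module R L \<and> bij_betw \<phi> (carrier M) (carrier L) \<and>
     (\<forall>x\<in>carrier M. \<forall>y\<in>carrier M. \<phi> (x \<oplus>\<^bsub>M\<^esub> y) = \<phi> x \<oplus>\<^bsub>L\<^esub> \<phi> y) \<and>
     (\<forall>a\<in>carrier R. \<forall>x\<in>carrier M. \<phi> (a \<odot>\<^bsub>M\<^esub> x) = a \<odot>\<^bsub>L\<^esub> \<phi> x)"

text \<open>An \<open>R\<close>-module which is free and finitely generated over \<open>Z = \<complex>[[t]]\<close>, where \<open>\<zeta>\<close> is the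
  structure map from \<open>Z\<close> to \<open>R\<close>.\<close>

definition cm_module ::
  "('r, 'x) ring_scheme \<Rightarrow> (complex fps \<Rightarrow> 'r) \<Rightarrow> ('r, 'm, 'y) module_scheme \<Rightarrow> bool" where
  "cm_module R \<zeta> M \<longleftrightarrow> left_module R M \<and>
     (\<exists>(r::nat) b. b \<in> {..<r} \<rightarrow> carrier M \<and>
        (\<forall>x\<in>carrier M. \<exists>!z. z \<in> {..<r} \<rightarrow>\<^sub>E UNIV \<and>
            x = finsum M (\<lambda>i. \<zeta> (z i) \<odot>\<^bsub>M\<^esub> b i) {..<r}))"

definition restrict_scalars :: "('s \<Rightarrow> 'r) \<Rightarrow> ('r, 'm) module \<Rightarrow> ('s, 'm) module" where
  "restrict_scalars \<epsilon> M =
     \<lparr> carrier = carrier M, monoid.mult = monoid.mult M, one = one M,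
       ring.zero = ring.zero M, ring.add = ring.add M, smult = (\<lambda>a x. smult M (\<epsilon> a) x) \<rparr>"

text \<open>\<open>e R e\<close> and \<open>e M\<close> for an idempotent \<open>e\<close>.\<close>

definition corner_ring :: "'r ring \<Rightarrow> 'r \<Rightarrow> 'r ring" where
  "corner_ring R e = R \<lparr> carrier := {e \<otimes>\<^bsub>R\<^esub> a \<otimes>\<^bsub>R\<^esub> e | a. a \<in> carrier R}, one := e \<rparr>"

definition corner_module :: "'r \<Rightarrow> ('r, 'm) module \<Rightarrow> ('r, 'm) module" where
  "corner_module e M = M \<lparr> carrier := {e \<odot>\<^bsub>M\<^esub> x | x. x \<in> carrier M} \<rparr>"


section \<open>The dimer algebra and the boundary algebra\<close>

definition dimer_relations :: "diagram \<Rightarrow> (complex set, arrow) path_elt set" where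
  "dimer_relations D =
     {path_elem (arrow_head D \<alpha>) ps \<ominus>\<^bsub>path_algebra (dimer_quiver D)\<^esub> path_elem (arrow_head D \<alpha>) qs
      | \<alpha> ps qs. \<alpha> \<in> Crossing ` crossings D \<and>
          (\<exists>F. anticlockwise_region D F \<and> boundary_cycle D F (\<alpha> # ps)) \<and>
          (\<exists>F. clockwise_region D F \<and> boundary_cycle D F (\<alpha> # qs))}"

type_synonym dimer_elt = "(complex set, arrow) path_elt set"

definition dimer_algebra :: "diagram \<Rightarrow> dimer_elt ring" where
  "dimer_algebra D = path_quotient (dimer_quiver D) (dimer_relations D)"

definition dimer_class :: "diagram \<Rightarrow> (complex set, arrow) path_elt \<Rightarrow> dimer_elt" where
  "dimer_class D f = path_class (dimer_quiver D) (dimer_relations D) f"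

definition boundary_idempotent :: "diagram \<Rightarrow> dimer_elt" where
  "boundary_idempotent D =
     dimer_class D (\<lambda>(u, p). if u \<in> interval_region D ` {..<npts D} \<and> p = [] then 1 else 0)"

definition boundary_algebra :: "diagram \<Rightarrow> dimer_elt ring" where
  "boundary_algebra D = corner_ring (dimer_algebra D) (boundary_idempotent D)"

text \<open>
  A representative of \<open>t\<close> in the path algebra: the sum over the vertices of one face cycle each.
  The class in the dimer algebra does not depend on the choice of these cycles.
\<close>

definition face_cycle_at :: "diagram \<Rightarrow> complex set \<Rightarrow> arrow list \<Rightarrow> bool" where
  "face_cycle_at D v as \<longleftrightarrow> (\<exists>F. boundary_cycle D F as) \<and> arrow_tail D (hd as) = v"

definition dimer_t :: "diagram \<Rightarrow> (complex set, arrow) path_elt" where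
  "dimer_t D = (\<lambda>(v, as). if face_cycle_at D v as \<and> as = (SOME as. face_cycle_at D v as) then 1 else 0)"

definition boundary_scalar :: "diagram \<Rightarrow> complex fps \<Rightarrow> dimer_elt" where
  "boundary_scalar D f =
     boundary_idempotent D \<otimes>\<^bsub>dimer_algebra D\<^esub>
       dimer_class D (power_series_elem (dimer_quiver D) (dimer_t D) f)"


section \<open>The algebra C and the modules attached to subsets\<close>

datatype circle_arrow = ArrX nat | ArrY nat

fun circle_tail :: "nat \<Rightarrow> circle_arrow \<Rightarrow> nat" where
  "circle_tail n (ArrX i) = interval_before n i"
| "circle_tail n (ArrY i) = i"

fun circle_head :: "nat \<Rightarrow> circle_arrow \<Rightarrow> nat" where
  "circle_head n (ArrX i) = i"
| "circle_head n (ArrY i) = interval_before n i"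

definition circle_quiver :: "nat \<Rightarrow> (nat, circle_arrow) pre_digraph" where
  "circle_quiver n =
     \<lparr> verts = {..<n}, arcs = ArrX ` {..<n} \<union> ArrY ` {..<n},
       tail = circle_tail n, head = circle_head n \<rparr>"

definition circle_x :: "nat \<Rightarrow> (nat, circle_arrow) path_elt" where
  "circle_x n = (\<lambda>\<pi>. \<Sum>i<n. arrow_elem (circle_quiver n) (ArrX i) \<pi>)"

definition circle_y :: "nat \<Rightarrow> (nat, circle_arrow) path_elt" where
  "circle_y n = (\<lambda>\<pi>. \<Sum>i<n. arrow_elem (circle_quiver n) (ArrY i) \<pi>)"

definition circle_relations :: "nat \<Rightarrow> nat \<Rightarrow> (nat, circle_arrow) path_elt set" where
  "circle_relations k n =
     (let P = path_algebra (circle_quiver n); x = circle_x n; y = circle_y n in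
      {x \<otimes>\<^bsub>P\<^esub> y \<ominus>\<^bsub>P\<^esub> y \<otimes>\<^bsub>P\<^esub> x, y [^]\<^bsub>P\<^esub> k \<ominus>\<^bsub>P\<^esub> x [^]\<^bsub>P\<^esub> (n - k)})"

type_synonym circle_elt = "(nat, circle_arrow) path_elt set"

definition circle_algebra :: "nat \<Rightarrow> nat \<Rightarrow> circle_elt ring" where
  "circle_algebra k n = path_quotient (circle_quiver n) (circle_relations k n)"

definition circle_class :: "nat \<Rightarrow> nat \<Rightarrow> (nat, circle_arrow) path_elt \<Rightarrow> circle_elt" where
  "circle_class k n f = path_class (circle_quiver n) (circle_relations k n) f"

definition circle_scalar :: "nat \<Rightarrow> nat \<Rightarrow> complex fps \<Rightarrow> circle_elt" where
  "circle_scalar k n f =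
     circle_class k n (power_series_elem (circle_quiver n)
       (circle_x n \<otimes>\<^bsub>path_algebra (circle_quiver n)\<^esub> circle_y n) f)"

text \<open>
  The representation with \<open>\<complex>[[t]]\<close> at each vertex in which the arrows in \<open>S\<close> act as \<open>t\<close> and all
  other arrows as the identity: a path \<open>p\<close> acts as \<open>t\<close> to the power \<open>weight S p\<close>.  The
  action of an infinite sum of paths is computed coefficientwise in \<open>t\<close>;
  for the circle quiver and a nonempty proper subset \<open>I\<close> below, only finitely many paths
  contribute to each coefficient.
\<close>

definition weight :: "'a set \<Rightarrow> 'a list \<Rightarrow> nat" where
  "weight S p = length (filter (\<lambda>a. a \<in> S) p)"

definition weight_action ::
  "('v, 'a) pre_digraph \<Rightarrow> 'a set \<Rightarrow> ('v, 'a) path_elt \<Rightarrow> ('v \<Rightarrow> complex fps) \<Rightarrow> 'v \<Rightarrow> complex fps" where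
  "weight_action G S f x v =
     Abs_fps (\<lambda>d. \<Sum>(u, p) \<in> {(u, p). pre_digraph.awalk G u p v \<and> weight S p \<le> d}.
       f (u, p) * fps_nth (x u) (d - weight S p))"

text \<open>All representatives of an element of C act in the same way if \<open>I\<close> has \<open>k\<close> elements.\<close>

definition subset_module :: "nat \<Rightarrow> nat set \<Rightarrow> (circle_elt, nat \<Rightarrow> complex fps) module" where
  "subset_module n I =
     \<lparr> carrier = {x. \<forall>j. j \<ge> n \<longrightarrow> x j = 0}, monoid.mult = undefined, one = undefined,
       ring.zero = (\<lambda>_. 0), ring.add = (\<lambda>x y j. x j + y j),
       smult = (\<lambda>c x. the_elem
         ((\<lambda>f. weight_action (circle_quiver n) (ArrX ` ({..<n} \<inter> I) \<union> ArrY ` ({..<n} - I)) f x) ` c)) \<rparr>"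

text \<open>The canonical map from C to the boundary algebra: a homomorphism of algebras over the
  complex numbers with the prescribed values on idempotents and arrows.\<close>

definition canonical_map :: "diagram \<Rightarrow> nat \<Rightarrow> (circle_elt \<Rightarrow> dimer_elt) \<Rightarrow> bool" where
  "canonical_map D k \<epsilon> \<longleftrightarrow>
     (let n = npts D; Q = circle_quiver n in
      \<epsilon> \<in> ring_hom (circle_algebra k n) (boundary_algebra D) \<and>
      (\<forall>c. \<epsilon> (circle_class k n (scalar_elem Q c)) =
           dimer_class D (scalar_elem (dimer_quiver D) c) \<otimes>\<^bsub>dimer_algebra D\<^esub> boundary_idempotent D) \<and>
      (\<forall>j<n. \<epsilon> (circle_class k n (path_elem j [])) = dimer_class D (path_elem (interval_region D j) [])) \<and>
      (\<forall>i<n. \<exists>F ps. boundary_cycle D F (Boundary i # ps) \<and>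
         (let arr = dimer_class D (arrow_elem (dimer_quiver D) (Boundary i));
              compl = dimer_class D (path_elem (arrow_head D (Boundary i)) ps)
          in \<epsilon> (circle_class k n (arrow_elem Q (ArrX i))) = (if clockwise_arrow D i then arr else compl) \<and>
             \<epsilon> (circle_class k n (arrow_elem Q (ArrY i))) = (if clockwise_arrow D i then compl else arr))))"


section \<open>Perfect matchings\<close>

definition perfect_matching :: "diagram \<Rightarrow> arrow set \<Rightarrow> bool" where
  "perfect_matching D \<mu> \<longleftrightarrow> \<mu> \<subseteq> dimer_arrows D \<and> (\<forall>F\<in>faces D. \<exists>!\<alpha>. \<alpha> \<in> corners D F \<and> \<alpha> \<in> \<mu>)"

definition boundary_value :: "diagram \<Rightarrow> arrow set \<Rightarrow> nat set" where
  "boundary_value D \<mu> = {i. i < npts D \<and> (clockwise_arrow D i \<longleftrightarrow> Boundary i \<in> \<mu>)}"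

text \<open>
  \<open>N\<close> is the module of the perfect matching \<open>\<mu>\<close>: a module over the dimer algebra whose
  elements are the families of power series indexed by the vertices, with complex
  scalars, vertex idempotents and arrows acting as prescribed.
\<close>

definition matching_module ::
  "diagram \<Rightarrow> arrow set \<Rightarrow> (dimer_elt, complex set \<Rightarrow> complex fps) module \<Rightarrow> bool" where
  "matching_module D \<mu> N \<longleftrightarrow>
     (let Q = dimer_quiver D in
      left_module (dimer_algebra D) N \<and>
      carrier N = {x. \<forall>v. v \<notin> verts Q \<longrightarrow> x v = 0} \<and>
      ring.zero N = (\<lambda>_. 0) \<and>
      (\<forall>x\<in>carrier N. \<forall>y\<in>carrier N. x \<oplus>\<^bsub>N\<^esub> y = (\<lambda>v. x v + y v)) \<and>
      (\<forall>c. \<forall>x\<in>carrier N. dimer_class D (scalar_elem Q c) \<odot>\<^bsub>N\<^esub> x = (\<lambda>v. fps_const c * x v)) \<and>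
      (\<forall>v\<in>verts Q. \<forall>x\<in>carrier N.
         dimer_class D (path_elem v []) \<odot>\<^bsub>N\<^esub> x = (\<lambda>w. if w = v then x v else 0)) \<and>
      (\<forall>\<alpha>\<in>arcs Q. \<forall>x\<in>carrier N.
         dimer_class D (arrow_elem Q \<alpha>) \<odot>\<^bsub>N\<^esub> x =
           (\<lambda>w. if w = head Q \<alpha> then (if \<alpha> \<in> \<mu> then fps_X else 1) * x (tail Q \<alpha>) else 0)))"

text \<open>Components at the boundary vertices, with boundary intervals in place of the
  regions containing them.\<close>

definition boundary_components :: "diagram \<Rightarrow> (complex set \<Rightarrow> complex fps) \<Rightarrow> nat \<Rightarrow> complex fps" where
  "boundary_components D x = (\<lambda>j. if j < npts D then x (interval_region D j) else 0)"

end

theory Submission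
  imports Defs
begin

text \<open>
  Let \<open>R\<close> be a complete path algebra acting on a family of power series so that each arrow acts as
  \<open>1\<close> or \<open>t\<close>.  No cycle \<open>c\<close> can act as the identity, because \<open>1 - c\<close> is invertible in \<open>R\<close>.  Hence
  long paths act by high powers of \<open>t\<close>, and although the action is not assumed to be continuous, the
  actions of arrows determine it: collecting the paths of length at least \<open>l\<close> by their final
  segments of length \<open>l\<close> exhibits the tail of a series as a finite sum of products \<open>q g\<close> with
  \<open>q\<close> a path of length \<open>l\<close>.  This applies to the dimer algebra acting on \<open>N\<close> and to \<open>C\<close> acting on
  \<open>e N\<close> through \<open>\<epsilon>\<close>.  Since \<open>\<mu>\<close> meets each face in one arrow, the completion of a boundary arrow to
  a face cycle has weight complementary to that of the arrow, so that \<open>x\<^sub>i\<close> and \<open>y\<^sub>i\<close> act on \<open>e N\<close> as on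
  the module of \<open>\<partial>\<mu>\<close>.

  The topology of the diagram enters only through the finiteness of the crossings.  That the
  boundary regions are pairwise distinct vertices and that heads of arrows are vertices follows
  from the existence of \<open>N\<close> and \<open>\<epsilon>\<close>; likewise the relations of \<open>C\<close> hold on the module of \<open>\<partial>\<mu>\<close>
  because \<open>\<epsilon>\<close> makes \<open>e N\<close> a module over \<open>C\<close>.
\<close>

section \<open>Paths\<close>

context pre_digraph
begin

lemma cas_append: "cas u (p @ q) v \<longleftrightarrow> (\<exists>w. cas u p w \<and> cas w q v)"
  by (induction p arbitrary: u) auto

lemma cas_awlast: "cas u p v \<Longrightarrow> awlast u p = v"
  by (induction p arbitrary: u) auto

lemma awlast_append: "awlast (awlast u p) q = awlast u (p @ q)"
  by (simp add: awalk_verts_conv)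

end

text \<open>Weaker than \<open>wf_digraph\<close>: arrows whose tail is not a vertex lie on no path.\<close>

definition heads_closed :: "('v, 'a) pre_digraph \<Rightarrow> bool" where
  "heads_closed G \<longleftrightarrow> (\<forall>a\<in>arcs G. tail G a \<in> verts G \<longrightarrow> head G a \<in> verts G)"

text \<open>\<open>awalk\<close> checks only its start vertex for membership in
  \<open>verts\<close>, so removing the first arrow leaves a walk only if the head of that arrow is
  a vertex as well.\<close>

lemma awalk_Cons:
  assumes "heads_closed G"
  shows "pre_digraph.awalk G u (a # p) v \<longleftrightarrow>
    u \<in> verts G \<and> a \<in> arcs G \<and> tail G a = u \<and> pre_digraph.awalk G (head G a) p v"
  using assms unfolding heads_closed_def pre_digraph.awalk_def pre_digraph.cas.simps by auto

lemma awalk_end_in_verts: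
  assumes "heads_closed G" "pre_digraph.awalk G u p v"
  shows "v \<in> verts G"
  using assms(2)
proof (induction p arbitrary: u)
  case (Cons a p)
  then show ?case
    by (auto simp: awalk_Cons[OF assms(1)])
qed (auto simp: pre_digraph.awalk_def pre_digraph.cas.simps)

lemma awalk_append:
  assumes "heads_closed G"
  shows "pre_digraph.awalk G u (p @ q) v \<longleftrightarrow>
    (\<exists>w. pre_digraph.awalk G u p w \<and> pre_digraph.awalk G w q v)"
proof
  assume pq: "pre_digraph.awalk G u (p @ q) v"
  then obtain w where "pre_digraph.cas G u p w" "pre_digraph.cas G w q v"
    by (auto simp: pre_digraph.awalk_def pre_digraph.cas_append)
  moreover from this pq have "pre_digraph.awalk G u p w"
    by (auto simp: pre_digraph.awalk_def)
  ultimately show "\<exists>w. pre_digraph.awalk G u p w \<and> pre_digraph.awalk G w q v"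
    using awalk_end_in_verts[OF assms, of u p w] pq by (auto simp: pre_digraph.awalk_def)
next
  assume "\<exists>w. pre_digraph.awalk G u p w \<and> pre_digraph.awalk G w q v"
  then show "pre_digraph.awalk G u (p @ q) v"
    unfolding pre_digraph.awalk_def pre_digraph.cas_append by auto
qed

lemma awalk_iff_paths:
  "pre_digraph.awalk G u p v \<longleftrightarrow> (u, p) \<in> paths G \<and> pre_digraph.awlast G u p = v"
  unfolding paths_def pre_digraph.awalk_def using pre_digraph.cas_awlast[of G u p] by blast

lemma in_paths_iff:
  "(u, p) \<in> paths G \<longleftrightarrow> pre_digraph.awalk G u p (pre_digraph.awlast G u p)"
  by (simp add: awalk_iff_paths)

lemma Nil_in_paths_iff [simp]: "(u, []) \<in> paths G \<longleftrightarrow> u \<in> verts G"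
  by (auto simp: paths_def pre_digraph.awalk_def pre_digraph.cas.simps)

lemma arc_in_paths:
  assumes "a \<in> arcs G" "tail G a \<in> verts G"
  shows "(tail G a, [a]) \<in> paths G"
  using assms by (auto simp: paths_def pre_digraph.awalk_def pre_digraph.cas.simps)

lemma take_in_paths:
  assumes "(u, p) \<in> paths G"
  shows "(u, take m p) \<in> paths G"
proof -
  obtain v where v: "u \<in> verts G" "set p \<subseteq> arcs G" "pre_digraph.cas G u p v"
    using assms by (auto simp: paths_def pre_digraph.awalk_def)
  moreover obtain w where "pre_digraph.cas G u (take m p) w"
    using v(3) pre_digraph.cas_append[of G u "take m p" "drop m p" v] by auto
  ultimately show ?thesis
    using set_take_subset[of m p] by (auto simp: paths_def pre_digraph.awalk_def)
qed

lemma paths_appendI: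
  assumes "(u, p) \<in> paths G" "(pre_digraph.awlast G u p, q) \<in> paths G"
  shows "(u, p @ q) \<in> paths G"
proof -
  let ?w = "pre_digraph.awlast G u p"
  have "pre_digraph.awalk G u p ?w"
    using assms(1) by (simp add: in_paths_iff)
  moreover obtain v where "pre_digraph.awalk G ?w q v"
    using assms(2) by (auto simp: paths_def)
  ultimately have "pre_digraph.awalk G u (p @ q) v"
    by (auto simp: pre_digraph.awalk_def pre_digraph.cas_append)
  then show ?thesis by (auto simp: paths_def)
qed

lemma awlast_Nil [simp]: "pre_digraph.awlast G u [] = u"
  by (simp add: pre_digraph.awalk_verts_conv)

section \<open>The complete path algebra\<close>

lemma path_algebra_sel:
  shows path_carrier: "carrier (path_algebra G) = {f. \<forall>\<pi>. \<pi> \<notin> paths G \<longrightarrow> f \<pi> = 0}"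
    and path_mult: "monoid.mult (path_algebra G) f g = (\<lambda>(u, p). \<Sum>m\<le>length p.
          g (u, take m p) * f (pre_digraph.awlast G u (take m p), drop m p))"
    and path_one: "one (path_algebra G) = (\<lambda>(u, p). if u \<in> verts G \<and> p = [] then 1 else 0)"
    and path_zero: "ring.zero (path_algebra G) = (\<lambda>_. 0)"
    and path_add: "ring.add (path_algebra G) f g = (\<lambda>\<pi>. f \<pi> + g \<pi>)"
  by (simp_all add: path_algebra_def)

lemma path_carrierI: "(\<And>u p. (u, p) \<notin> paths G \<Longrightarrow> f (u, p) = 0) \<Longrightarrow> f \<in> carrier (path_algebra G)"
  by (auto simp: path_carrier)

lemma path_carrierD: "f \<in> carrier (path_algebra G) \<Longrightarrow> \<pi> \<notin> paths G \<Longrightarrow> f \<pi> = 0"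
  by (cases \<pi>) (auto simp: path_carrier)

lemma path_mult_closed:
  assumes "f \<in> carrier (path_algebra G)" "g \<in> carrier (path_algebra G)"
  shows "f \<otimes>\<^bsub>path_algebra G\<^esub> g \<in> carrier (path_algebra G)"
proof (rule path_carrierI)
  fix u p assume "(u, p) \<notin> paths G"
  then have "g (u, take m p) * f (pre_digraph.awlast G u (take m p), drop m p) = 0" for m
    using paths_appendI[of u "take m p" G "drop m p"] assms by (auto simp: path_carrier)
  then show "(f \<otimes>\<^bsub>path_algebra G\<^esub> g) (u, p) = 0"
    unfolding path_mult by (simp only: prod.case sum.neutral_const)
qed

text \<open>Both sides sum over the ways to cut \<open>p\<close> at two places; they differ in which
  cut is chosen first.\<close>

lemma path_mult_assoc:
  "(f \<otimes>\<^bsub>path_algebra G\<^esub> g) \<otimes>\<^bsub>path_algebra G\<^esub> h = f \<otimes>\<^bsub>path_algebra G\<^esub> (g \<otimes>\<^bsub>path_algebra G\<^esub> h)"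
proof (rule ext, clarify)
  fix u p
  let ?N = "length p" and ?a = "\<lambda>m. pre_digraph.awlast G u (take m p)"
  have last: "pre_digraph.awlast G (?a l) (take j (drop l p)) = ?a (l + j)" for l j
    unfolding pre_digraph.awlast_append by (simp add: take_add)
  have "((f \<otimes>\<^bsub>path_algebra G\<^esub> g) \<otimes>\<^bsub>path_algebra G\<^esub> h) (u, p) =
      (\<Sum>l\<le>?N. \<Sum>j\<le>?N - l. h (u, take l p) *
        (g (?a l, take j (drop l p)) * f (?a (l + j), drop (l + j) p)))"
    by (simp add: path_mult sum_distrib_left last add.commute)
  also have "\<dots> = (\<Sum>(l, j)\<in>(SIGMA l:{..?N}. {..?N - l}). h (u, take l p) *
        (g (?a l, take j (drop l p)) * f (?a (l + j), drop (l + j) p)))"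
    by (subst sum.Sigma) auto
  \<comment> \<open>Passing from the first cut and the length of the middle piece to the second cut
    and the first cut.\<close>
  also have "\<dots> = (\<Sum>(m, l)\<in>(SIGMA m:{..?N}. {..m}). h (u, take l p) *
        (g (?a l, drop l (take m p)) * f (?a m, drop m p)))"
    by (rule sum.reindex_bij_witness[where i = "\<lambda>(m, l). (l, m - l)" and j = "\<lambda>(l, j). (l + j, l)"])
      (auto simp: drop_take)
  also have "\<dots> = (\<Sum>m\<le>?N. \<Sum>l\<le>m. h (u, take l p) *
        (g (?a l, drop l (take m p)) * f (?a m, drop m p)))"
    by (subst sum.Sigma) auto
  also have "\<dots> = (f \<otimes>\<^bsub>path_algebra G\<^esub> (g \<otimes>\<^bsub>path_algebra G\<^esub> h)) (u, p)"
    by (auto simp: path_mult sum_distrib_right mult.assoc min_absorb1 min_absorb2 intro!: sum.cong)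
  finally show "((f \<otimes>\<^bsub>path_algebra G\<^esub> g) \<otimes>\<^bsub>path_algebra G\<^esub> h) (u, p) =
    (f \<otimes>\<^bsub>path_algebra G\<^esub> (g \<otimes>\<^bsub>path_algebra G\<^esub> h)) (u, p)" .
qed

text \<open>The unit, scalars, vertex idempotents and the boundary idempotent all have this shape,
  so \<open>P\<close> and \<open>c\<close> are kept general. Multiplying on the left means composing
  afterwards, hence the condition falls on the end of the path; in \<open>vertex_mult_right\<close>
  it falls on the start.\<close>

lemma vertex_mult_left:
  "(\<lambda>(u, p). if P u \<and> p = [] then c else 0) \<otimes>\<^bsub>path_algebra G\<^esub> f =
    (\<lambda>(u, p). if P (pre_digraph.awlast G u p) then c * f (u, p) else 0)"
proof (rule ext, clarify)
  fix u p
  have "(\<Sum>m\<le>length p. f (u, take m p) *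
          (if P (pre_digraph.awlast G u (take m p)) \<and> drop m p = [] then c else 0)) =
      (\<Sum>m\<le>length p. if m = length p then
          (if P (pre_digraph.awlast G u p) then c * f (u, p) else 0) else 0)"
    by (rule sum.cong) auto
  then show "((\<lambda>(u, p). if P u \<and> p = [] then c else 0) \<otimes>\<^bsub>path_algebra G\<^esub> f) (u, p) =
      (if P (pre_digraph.awlast G u p) then c * f (u, p) else 0)"
    by (simp add: path_mult)
qed

lemma vertex_mult_right:
  "f \<otimes>\<^bsub>path_algebra G\<^esub> (\<lambda>(u, p). if P u \<and> p = [] then c else 0) =
    (\<lambda>(u, p). if P u then c * f (u, p) else 0)"
proof (rule ext, clarify)
  fix u p
  have "(\<Sum>m\<le>length p. (if P u \<and> take m p = [] then c else 0) *
          f (pre_digraph.awlast G u (take m p), drop m p)) =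
      (\<Sum>m\<le>length p. if m = 0 then (if P u then c * f (u, p) else 0) else 0)"
    by (rule sum.cong) auto
  then show "(f \<otimes>\<^bsub>path_algebra G\<^esub> (\<lambda>(u, p). if P u \<and> p = [] then c else 0)) (u, p) =
      (if P u then c * f (u, p) else 0)"
    by (simp add: path_mult)
qed

lemma path_elem_Nil: "path_elem v [] = (\<lambda>(u, p). if u = v \<and> p = [] then 1 else 0)"
  by (auto simp: path_elem_def fun_eq_iff)

lemma path_elem_carrier: "(u, p) \<in> paths G \<Longrightarrow> path_elem u p \<in> carrier (path_algebra G)"
  by (auto simp: path_carrier path_elem_def)

lemma scalar_elem_carrier: "scalar_elem G c \<in> carrier (path_algebra G)"
  by (auto simp: path_carrier scalar_elem_def)

lemma path_abelian_group: "abelian_group (path_algebra G)"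
proof (rule abelian_groupI)
  fix f assume "f \<in> carrier (path_algebra G)"
  then show "\<exists>g\<in>carrier (path_algebra G). g \<oplus>\<^bsub>path_algebra G\<^esub> f = \<zero>\<^bsub>path_algebra G\<^esub>"
    by (intro bexI[of _ "\<lambda>\<pi>. - f \<pi>"]) (auto simp: path_algebra_sel)
qed (auto simp: path_algebra_sel algebra_simps)

lemma ring_path_algebra:
  assumes "heads_closed G"
  shows "ring (path_algebra G)"
proof (rule ringI)
  show "abelian_group (path_algebra G)" by (rule path_abelian_group)
  show "monoid (path_algebra G)"
  proof
    show "\<one>\<^bsub>path_algebra G\<^esub> \<in> carrier (path_algebra G)"
      by (auto simp: path_carrier path_one)
    fix f assume f: "f \<in> carrier (path_algebra G)"
    \<comment> \<open>The left unit tests the end of each path, which \<open>heads_closed\<close>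
      makes a vertex; the right unit tests the start, a vertex by definition of walks.\<close>
    show "\<one>\<^bsub>path_algebra G\<^esub> \<otimes>\<^bsub>path_algebra G\<^esub> f = f"
      using path_carrierD[OF f] awalk_end_in_verts[OF assms]
      by (fastforce simp: path_one vertex_mult_left in_paths_iff)
    show "f \<otimes>\<^bsub>path_algebra G\<^esub> \<one>\<^bsub>path_algebra G\<^esub> = f"
      using path_carrierD[OF f]
      by (fastforce simp: path_one vertex_mult_right in_paths_iff pre_digraph.awalk_def)
  qed (auto simp: path_mult_assoc path_mult_closed)
qed (auto simp: path_mult path_add fun_eq_iff algebra_simps sum.distrib)

text \<open>Multiplication by one on the left erases a path whose end is not a vertex, so the unit
  law for a single arrow forces its head to be one. This gives \<open>heads_closed\<close> for the
  quiver of a diagram without a look at its topology.\<close>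

lemma heads_closed_if_ring:
  assumes "ring (path_algebra G)"
  shows "heads_closed G"
  unfolding heads_closed_def
proof (intro ballI impI)
  fix a assume a: "a \<in> arcs G" "tail G a \<in> verts G"
  interpret ring "path_algebra G" by fact
  have "\<one>\<^bsub>path_algebra G\<^esub> \<otimes>\<^bsub>path_algebra G\<^esub> path_elem (tail G a) [a] = path_elem (tail G a) [a]"
    by (intro l_one path_elem_carrier arc_in_paths a)
  from fun_cong[OF this, of "(tail G a, [a])"] show "head G a \<in> verts G"
    by (simp add: path_one vertex_mult_left path_elem_def pre_digraph.awalk_verts.simps
        split: if_splits)
qed

lemma path_minus:
  assumes "f \<in> carrier (path_algebra G)"
  shows "\<ominus>\<^bsub>path_algebra G\<^esub> f = (\<lambda>\<pi>. - f \<pi>)"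
proof -
  interpret abelian_group "path_algebra G" by (rule path_abelian_group)
  show ?thesis
    using assms by (intro minus_equality) (auto simp: path_algebra_sel)
qed

lemma path_elem_mult:
  assumes "pre_digraph.awlast G u p = v"
  shows "path_elem v q \<otimes>\<^bsub>path_algebra G\<^esub> path_elem u p = path_elem u (p @ q)"
proof (rule ext, clarify)
  fix u' r
  \<comment> \<open>Only the cut after the first \<open>length p\<close> arrows can return
    \<open>p\<close> as the initial piece.\<close>
  have "(\<Sum>m\<le>length r. path_elem u p (u', take m r) *
        path_elem v q (pre_digraph.awlast G u' (take m r), drop m r)) =
      (\<Sum>m\<le>length r. if m = length p then path_elem u (p @ q) (u', r) else 0)"
  proof (rule sum.cong)
    fix m assume "m \<in> {..length r}"
    then have len: "length (take m r) = m" by simp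
    show "path_elem u p (u', take m r) *
        path_elem v q (pre_digraph.awlast G u' (take m r), drop m r) =
        (if m = length p then path_elem u (p @ q) (u', r) else 0)"
    proof (cases "u' = u \<and> take m r = p")
      case True
      then have "r = p @ q \<longleftrightarrow> drop m r = q"
        by (metis append_take_drop_id same_append_eq)
      then show ?thesis
        using True len assms by (simp add: path_elem_def)
    next
      case False
      then have "m \<noteq> length p \<or> (u', r) \<noteq> (u, p @ q)" by auto
      then have "(if m = length p then path_elem u (p @ q) (u', r) else 0) = 0"
        unfolding path_elem_def by argo
      moreover have "path_elem u p (u', take m r) = 0"
        using False unfolding path_elem_def by simp
      ultimately show ?thesis by (simp only: mult_zero_left)
    qed
  qed simp
  also have "\<dots> = path_elem u (p @ q) (u', r)"
    by (simp add: path_elem_def)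
  finally show "(path_elem v q \<otimes>\<^bsub>path_algebra G\<^esub> path_elem u p) (u', r) = path_elem u (p @ q) (u', r)"
    by (simp only: path_mult prod.case)
qed

lemma awlast_in_verts:
  assumes "heads_closed G" "(u, p) \<in> paths G"
  shows "pre_digraph.awlast G u p \<in> verts G"
  using assms awalk_end_in_verts by (auto simp: in_paths_iff)

lemma scalar_mult_left:
  assumes "heads_closed G" "f \<in> carrier (path_algebra G)"
  shows "scalar_elem G c \<otimes>\<^bsub>path_algebra G\<^esub> f = (\<lambda>\<pi>. c * f \<pi>)"
proof (rule ext, clarify)
  fix u p
  show "(scalar_elem G c \<otimes>\<^bsub>path_algebra G\<^esub> f) (u, p) = c * f (u, p)"
    unfolding scalar_elem_def vertex_mult_left
    using path_carrierD[OF assms(2), of "(u, p)"] awlast_in_verts[OF assms(1), of u p] by auto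
qed

section \<open>Closed ideals\<close>

lemma closed_ideal_carrier: "closed_ideal G S \<subseteq> carrier (path_algebra G)"
  by (auto simp: closed_ideal_def)

text \<open>No set is an ideal of a structure which is not a ring, so that \<open>Idl S\<close> is then \<open>UNIV\<close>.\<close>

lemma closed_ideal_degenerate:
  assumes "\<not> ring (path_algebra G) \<or> \<not> S \<subseteq> carrier (path_algebra G)"
  shows "closed_ideal G S = carrier (path_algebra G)"
proof -
  have "\<not> (ideal I (path_algebra G) \<and> S \<subseteq> I)" for I
    using assms ideal.axioms(2)[of I "path_algebra G"] ideal.Icarr[of I "path_algebra G"]
    by (meson subset_iff)
  then have "{I. ideal I (path_algebra G) \<and> S \<subseteq> I} = {}"
    by blast
  then have "Idl\<^bsub>path_algebra G\<^esub> S = UNIV"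
    unfolding genideal_def by (simp only: Inter_empty)
  then show ?thesis
    unfolding closed_ideal_def by auto
qed

text \<open>The coefficients of sums, negatives and products on paths shorter than \<open>l\<close>
  depend only on those of the operands on paths shorter than \<open>l\<close>, so approximations by
  elements of the ideal can be combined. If \<open>S\<close> leaves the carrier, the closed ideal is
  the whole ring.\<close>

lemma ideal_closed_ideal:
  assumes "ring (path_algebra G)"
  shows "ideal (closed_ideal G S) (path_algebra G)"
proof (cases "S \<subseteq> carrier (path_algebra G)")
  case False
  then show ?thesis
    using closed_ideal_degenerate[of G S] ring.oneideal[OF assms] by auto
next
  case True
  let ?P = "path_algebra G" and ?J = "Idl\<^bsub>path_algebra G\<^esub> S"
  interpret ring ?P by fact
  interpret J: ideal ?J ?P using genideal_ideal[OF True] .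
  \<comment> \<open>Elements of the carrier vanish off \<open>paths\<close>, so the comparison may
    range over all short lists; the pieces of a path in a product can then be compared
    directly.\<close>
  define agree :: "nat \<Rightarrow> ('a, 'b) path_elt \<Rightarrow> ('a, 'b) path_elt \<Rightarrow> bool"
    where "agree l f g \<longleftrightarrow> (\<forall>u p. length p < l \<longrightarrow> f (u, p) = g (u, p))" for l f g
  have closed: "closed_ideal G S = {f \<in> carrier ?P. \<forall>l. \<exists>g\<in>?J. agree l f g}"
  proof -
    have "(\<forall>(u, p)\<in>paths G. length p < l \<longrightarrow> f (u, p) = g (u, p)) \<longleftrightarrow> agree l f g"
      if "f \<in> carrier ?P" "g \<in> ?J" for f g l
    proof -
      have out: "f \<pi> = g \<pi>" if "\<pi> \<notin> paths G" for \<pi>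
        using path_carrierD[OF \<open>f \<in> carrier ?P\<close> that]
          path_carrierD[OF J.Icarr[OF \<open>g \<in> ?J\<close>] that] by simp
      show ?thesis
        unfolding agree_def
      proof (intro iffI allI impI)
        fix u :: 'a and p :: "'b list"
        assume "\<forall>(u, p)\<in>paths G. length p < l \<longrightarrow> f (u, p) = g (u, p)" "length p < l"
        then show "f (u, p) = g (u, p)"
          using out[of "(u, p)"] by (cases "(u, p) \<in> paths G") auto
      qed auto
    qed
    then show ?thesis
      unfolding closed_ideal_def by (intro Collect_cong conj_cong all_cong1 bex_cong refl) simp
  qed
  show ?thesis
  proof (rule idealI)
    show "subgroup (closed_ideal G S) (add_monoid ?P)"
    proof (rule group.subgroupI)
      show "group (add_monoid ?P)" by (rule a_group)
      have "\<zero>\<^bsub>?P\<^esub> \<in> closed_ideal G S"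
        unfolding closed agree_def by auto
      then show "closed_ideal G S \<noteq> {}" by blast
      fix f assume f: "f \<in> closed_ideal G S"
      have "\<ominus>\<^bsub>?P\<^esub> f \<in> closed_ideal G S"
        unfolding closed
      proof (clarsimp, intro conjI allI)
        show "\<ominus>\<^bsub>?P\<^esub> f \<in> carrier ?P" using f closed by auto
        fix l
        obtain g where g: "g \<in> ?J" "agree l f g" using f closed by blast
        have "agree l (\<ominus>\<^bsub>?P\<^esub> f) (\<ominus>\<^bsub>?P\<^esub> g)"
          using f g J.Icarr[of g] closed by (auto simp: agree_def path_minus)
        then show "\<exists>g\<in>?J. agree l (\<ominus>\<^bsub>?P\<^esub> f) g"
          using g J.a_inv_closed by blast
      qed
      then show "inv\<^bsub>add_monoid ?P\<^esub> f \<in> closed_ideal G S"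
        by (simp add: a_inv_def)
      fix f' assume f': "f' \<in> closed_ideal G S"
      have "f \<oplus>\<^bsub>?P\<^esub> f' \<in> closed_ideal G S"
        unfolding closed
      proof (clarsimp, intro conjI allI)
        show "f \<oplus>\<^bsub>?P\<^esub> f' \<in> carrier ?P" using f f' closed by auto
        fix l
        obtain g g' where g: "g \<in> ?J" "agree l f g" "g' \<in> ?J" "agree l f' g'"
          using f f' closed by blast
        then have "agree l (f \<oplus>\<^bsub>?P\<^esub> f') (g \<oplus>\<^bsub>?P\<^esub> g')"
          by (auto simp: agree_def path_add)
        then show "\<exists>g\<in>?J. agree l (f \<oplus>\<^bsub>?P\<^esub> f') g"
          using g J.a_closed by blast
      qed
      then show "f \<otimes>\<^bsub>add_monoid ?P\<^esub> f' \<in> closed_ideal G S" by simp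
    qed (use closed in auto)
  next
    fix f a assume f: "f \<in> closed_ideal G S" and a: "a \<in> carrier ?P"
    show "a \<otimes>\<^bsub>?P\<^esub> f \<in> closed_ideal G S"
      unfolding closed
    proof (clarsimp, intro conjI allI)
      show "a \<otimes>\<^bsub>?P\<^esub> f \<in> carrier ?P" using f a closed by auto
      fix l
      obtain g where g: "g \<in> ?J" "agree l f g" using f closed by blast
      then have "agree l (a \<otimes>\<^bsub>?P\<^esub> f) (a \<otimes>\<^bsub>?P\<^esub> g)"
        by (auto simp: agree_def path_mult intro!: sum.cong)
      then show "\<exists>g\<in>?J. agree l (a \<otimes>\<^bsub>?P\<^esub> f) g"
        using J.I_l_closed[OF g(1) a] by blast
    qed
    show "f \<otimes>\<^bsub>?P\<^esub> a \<in> closed_ideal G S"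
      unfolding closed
    proof (clarsimp, intro conjI allI)
      show "f \<otimes>\<^bsub>?P\<^esub> a \<in> carrier ?P" using f a closed by auto
      fix l
      obtain g where g: "g \<in> ?J" "agree l f g" using f closed by blast
      then have "agree l (f \<otimes>\<^bsub>?P\<^esub> a) (g \<otimes>\<^bsub>?P\<^esub> a)"
        by (auto simp: agree_def path_mult intro!: sum.cong)
      then show "\<exists>g\<in>?J. agree l (f \<otimes>\<^bsub>?P\<^esub> a) g"
        using J.I_r_closed[OF g(1) a] by blast
    qed
  qed (rule ring_axioms)
qed

section \<open>Classes in the quotient and their representatives\<close>

lemma path_class_hom:
  assumes "ring (path_algebra G)"
  shows "path_class G S \<in> ring_hom (path_algebra G) (path_quotient G S)"
  using ideal.rcos_ring_hom[OF ideal_closed_ideal[OF assms, of S]]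
  by (simp add: path_class_def[abs_def] path_quotient_def)

lemma ring_path_quotient:
  assumes "ring (path_algebra G)"
  shows "ring (path_quotient G S)"
  unfolding path_quotient_def
  by (rule ideal.quotient_is_ring[OF ideal_closed_ideal[OF assms]])

lemma path_class_eq: "path_class G S f = {\<lambda>\<pi>. h \<pi> + f \<pi> | h. h \<in> closed_ideal G S}"
  by (auto simp: path_class_def a_r_coset_def r_coset_def path_add)

lemma path_quotient_carrier:
  "carrier (path_quotient G S) = path_class G S ` carrier (path_algebra G)"
  by (auto simp: path_quotient_def FactRing_def A_RCOSETS_def' path_class_def)

text \<open>The product is a union of cosets over all pairs of representatives, so it has a meaning
  for arbitrary sets; \<open>path_quotient_mult_vertex\<close> exploits this before the factors are
  known to be classes.\<close>

lemma path_quotient_mult: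
  "monoid.mult (path_quotient G S) a b =
    (\<Union>f\<in>a. \<Union>g\<in>b. path_class G S (f \<otimes>\<^bsub>path_algebra G\<^esub> g))"
  by (simp add: path_quotient_def FactRing_def rcoset_mult_def path_class_def)

lemma zero_in_closed_ideal: "(\<lambda>_. 0) \<in> closed_ideal G S"
proof (cases "ring (path_algebra G)")
  case True
  then interpret ideal "closed_ideal G S" "path_algebra G" by (rule ideal_closed_ideal)
  show ?thesis
    using additive_subgroup.zero_closed[OF is_additive_subgroup] by (simp add: path_zero)
next
  case False
  then show ?thesis by (simp add: closed_ideal_degenerate path_carrier)
qed

lemma path_class_self: "f \<in> path_class G S f"
  unfolding path_class_eq using zero_in_closed_ideal by force

text \<open>The closed ideal is then the whole carrier, and translating it by one of its elements
  changes nothing. Thus all classes coincide with zero, which \<open>ring_P\<close> turns into a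
  contradiction.\<close>

lemma path_class_degenerate:
  assumes "\<not> ring (path_algebra G)" "f \<in> carrier (path_algebra G)"
  shows "path_class G S f = carrier (path_algebra G)"
proof -
  have "g \<in> path_class G S f" if "g \<in> carrier (path_algebra G)" for g
    unfolding path_class_eq closed_ideal_degenerate[OF disjI1, OF assms(1)]
    using that assms(2) by (auto simp: path_carrier intro!: exI[of _ "\<lambda>\<pi>. g \<pi> - f \<pi>"])
  moreover have "path_class G S f \<subseteq> carrier (path_algebra G)"
    using assms(2) closed_ideal_carrier[of G S] by (fastforce simp: path_class_eq path_carrier)
  ultimately show ?thesis by blast
qed

lemma path_quotient_zero: "\<zero>\<^bsub>path_quotient G S\<^esub> = closed_ideal G S"
  by (simp add: path_quotient_def FactRing_def)

text \<open>This holds even if \<open>x\<close> and \<open>y\<close> are not elements of the quotient.\<close>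

lemma path_quotient_mult_vertex:
  assumes a: "a \<in> carrier (path_quotient G S)" and "u \<notin> verts G"
    and f: "f \<in> x \<otimes>\<^bsub>path_quotient G S\<^esub> a \<otimes>\<^bsub>path_quotient G S\<^esub> y"
  shows "f (u, []) = 0"
proof -
  have carrier_0: "g (u, []) = 0" if "g \<in> carrier (path_algebra G)" for g
    using path_carrierD[OF that, of "(u, [])"] assms(2) by simp
  have class_0: "g (u, []) = h (u, [])" if "g \<in> path_class G S h" for g h
    using that carrier_0 closed_ideal_carrier[of G S] by (fastforce simp: path_class_eq)
  obtain b c where b: "b \<in> x \<otimes>\<^bsub>path_quotient G S\<^esub> a"
      and c: "f \<in> path_class G S (b \<otimes>\<^bsub>path_algebra G\<^esub> c)"
    using f unfolding path_quotient_mult[of G S _ y] by blast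
  obtain b1 b2 where b2: "b2 \<in> a" "b \<in> path_class G S (b1 \<otimes>\<^bsub>path_algebra G\<^esub> b2)"
    using b unfolding path_quotient_mult by blast
  obtain g where g: "g \<in> carrier (path_algebra G)" "a = path_class G S g"
    using a path_quotient_carrier by blast
  have "b2 (u, []) = 0"
    using class_0[of b2 g] b2(1) g carrier_0 by simp
  \<comment> \<open>On a trivial path the product involves only the coefficients of its factors on
    that path.\<close>
  then have "b (u, []) = 0"
    using class_0[OF b2(2)] by (simp add: path_mult)
  then show ?thesis
    using class_0[OF c] by (simp add: path_mult)
qed

lemma path_class_memD:
  assumes "ring (path_algebra G)" "c \<in> carrier (path_quotient G S)" "f \<in> c"
  shows "f \<in> carrier (path_algebra G)" "c = path_class G S f"
proof -
  interpret ideal "closed_ideal G S" "path_algebra G" by (rule ideal_closed_ideal[OF assms(1)])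
  obtain g where g: "g \<in> carrier (path_algebra G)" "c = path_class G S g"
    using assms(2) path_quotient_carrier by blast
  then show "f \<in> carrier (path_algebra G)"
    using assms(3) closed_ideal_carrier[of G S] by (fastforce simp: path_class_eq path_carrier)
  show "c = path_class G S f"
    using a_repr_independence'[of f g] g assms(3) by (simp add: path_class_def)
qed

section \<open>Power series representations\<close>

lemma weight_append [simp]: "weight S (p @ q) = weight S p + weight S q"
  by (simp add: weight_def)

lemma weight_simps [simp]:
  "weight S [] = 0" "weight S (a # p) = (if a \<in> S then 1 else 0) + weight S p"
  by (simp_all add: weight_def)

text \<open>\<open>act\<close> takes elements of the path algebra rather than classes, because
  \<open>weight_action\<close> is written in terms of the coefficients of a representative. The
  axiom \<open>act_arrow\<close> is limited to arrows with tail in \<open>verts\<close>, since the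
  others lie on no path.\<close>

locale power_series_rep =
  fixes G :: "('v, 'a) pre_digraph" and S :: "'a set"
    and act :: "('v, 'a) path_elt \<Rightarrow> ('v \<Rightarrow> complex fps) \<Rightarrow> 'v \<Rightarrow> complex fps"
    and V :: "('v \<Rightarrow> complex fps) set"
  assumes heads: "heads_closed G"
    and finite_arcs: "finite (arcs G)"
    and V_eq: "V = {x. \<forall>v. v \<notin> verts G \<longrightarrow> x v = 0}"
    and act_closed: "f \<in> carrier (path_algebra G) \<Longrightarrow> x \<in> V \<Longrightarrow> act f x \<in> V"
    and act_add: "f \<in> carrier (path_algebra G) \<Longrightarrow> g \<in> carrier (path_algebra G) \<Longrightarrow> x \<in> V \<Longrightarrow>
      act (\<lambda>\<pi>. f \<pi> + g \<pi>) x = (\<lambda>v. act f x v + act g x v)"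
    and act_mult: "f \<in> carrier (path_algebra G) \<Longrightarrow> g \<in> carrier (path_algebra G) \<Longrightarrow> x \<in> V \<Longrightarrow>
      act (f \<otimes>\<^bsub>path_algebra G\<^esub> g) x = act f (act g x)"
    and act_scalar: "x \<in> V \<Longrightarrow> act (scalar_elem G c) x = (\<lambda>v. fps_const c * x v)"
    and act_vertex: "v \<in> verts G \<Longrightarrow> x \<in> V \<Longrightarrow>
      act (path_elem v []) x = (\<lambda>w. if w = v then x v else 0)"
    and act_arrow: "a \<in> arcs G \<Longrightarrow> tail G a \<in> verts G \<Longrightarrow> x \<in> V \<Longrightarrow>
      act (arrow_elem G a) x =
        (\<lambda>w. if w = head G a then (if a \<in> S then fps_X else 1) * x (tail G a) else 0)"
begin

lemma act_smult:
  assumes "f \<in> carrier (path_algebra G)" "x \<in> V"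
  shows "act (\<lambda>\<pi>. c * f \<pi>) x = (\<lambda>v. fps_const c * act f x v)"
  using act_mult[OF scalar_elem_carrier assms, of c] act_scalar[OF act_closed[OF assms]]
  by (simp add: scalar_mult_left[OF heads assms(1)])

lemma act_zero: "x \<in> V \<Longrightarrow> act (\<lambda>_. 0) x = (\<lambda>_. 0)"
  using act_scalar[of x 0] by (simp add: scalar_elem_def split_def)

lemma act_sum:
  assumes "finite I" "\<And>i. i \<in> I \<Longrightarrow> f i \<in> carrier (path_algebra G)" "x \<in> V"
  shows "act (\<lambda>\<pi>. \<Sum>i\<in>I. f i \<pi>) x = (\<lambda>v. \<Sum>i\<in>I. act (f i) x v)"
  using assms(1,2)
proof (induction I rule: finite_induct)
  case empty
  then show ?case using act_zero[OF assms(3)] by simp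
next
  case (insert i I)
  have "(\<lambda>\<pi>. \<Sum>i\<in>I. f i \<pi>) \<in> carrier (path_algebra G)"
    using insert.prems by (auto simp: path_carrier intro: sum.neutral)
  then show ?case
    using insert act_add[OF _ _ assms(3), of "f i" "\<lambda>\<pi>. \<Sum>i\<in>I. f i \<pi>"] by simp
qed

lemma act_path:
  assumes "pre_digraph.awalk G u p v" "x \<in> V"
  shows "act (path_elem u p) x = (\<lambda>w. if w = v then fps_X ^ weight S p * x u else 0)"
  using assms
proof (induction p arbitrary: u x)
  case Nil
  then show ?case
    using act_vertex by (auto simp: pre_digraph.awalk_def pre_digraph.cas.simps)
next
  case (Cons a p)
  then have a: "a \<in> arcs G" "tail G a = u" "u \<in> verts G" and p: "pre_digraph.awalk G (head G a) p v"
    by (auto simp: awalk_Cons[OF heads])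
  have a_path: "(u, [a]) \<in> paths G"
    using arc_in_paths[of a G] a by simp
  have x': "act (arrow_elem G a) x \<in> V"
    using a_path a by (intro act_closed Cons.prems) (simp add: arrow_elem_def path_elem_carrier)
  have "path_elem u (a # p) = path_elem (head G a) p \<otimes>\<^bsub>path_algebra G\<^esub> path_elem u [a]"
    by (subst path_elem_mult) (simp_all add: pre_digraph.awalk_verts.simps)
  then have "act (path_elem u (a # p)) x = act (path_elem (head G a) p) (act (arrow_elem G a) x)"
    using a_path p a Cons.prems
    by (auto simp: arrow_elem_def paths_def intro!: act_mult path_elem_carrier)
  then show ?case
    using Cons.IH[OF p x'] act_arrow[of a x] a Cons.prems by (auto simp: fun_eq_iff mult.assoc)
qed

text \<open>If a cycle \<open>c\<close> acted as the identity, then \<open>1 - c\<close> would act as zero at its base point,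
  although the geometric series in \<open>c\<close> is an inverse.\<close>

lemma cycle_weight_pos:
  assumes "pre_digraph.awalk G v c v" "c \<noteq> []"
  shows "weight S c \<noteq> 0"
proof
  assume weight: "weight S c = 0"
  let ?P = "path_algebra G"
  have v: "v \<in> verts G" using assms(1) by (simp add: pre_digraph.awalk_def)
  have c: "(v, c) \<in> paths G" using assms(1) by (auto simp: paths_def)
  define g :: "('v, 'a) path_elt" where
    "g = (\<lambda>(u, p). if u = v \<and> (\<exists>m. p = concat (replicate m c)) then 1 else 0)"
  define x :: "'v \<Rightarrow> complex fps" where "x = (\<lambda>w. if w = v then 1 else 0)"
  have x: "x \<in> V" using v by (auto simp: V_eq x_def)
  have "pre_digraph.awalk G v (concat (replicate m c)) v" for m
  proof (induction m)
    case 0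
    then show ?case using v by (simp add: pre_digraph.awalk_def pre_digraph.cas.simps)
  next
    case (Suc m)
    then show ?case using assms(1) by (auto simp: awalk_append[OF heads])
  qed
  then have g: "g \<in> carrier ?P"
    by (force simp: path_carrier g_def paths_def)
  \<comment> \<open>Recursion of the geometric series: a power of \<open>c\<close> is empty or is
    \<open>c\<close> followed by a power of \<open>c\<close>.\<close>
  have "g = (\<lambda>\<pi>. path_elem v [] \<pi> + (g \<otimes>\<^bsub>?P\<^esub> path_elem v c) \<pi>)"
  proof (rule ext, clarify)
    fix u p
    have last: "pre_digraph.awlast G v c = v"
      using assms(1) by (simp add: awalk_iff_paths)
    have summand: "path_elem v c (u, take m p) * g (pre_digraph.awlast G u (take m p), drop m p) =
        (if m = length c then
          (if u = v \<and> take (length c) p = c then g (v, drop (length c) p) else 0) else 0)"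
      if "m \<le> length p" for m
    proof (cases "u = v \<and> take m p = c")
      case True
      then have "m = length c" using that by auto
      then show ?thesis using True last by (simp add: path_elem_def)
    next
      case False
      then have "path_elem v c (u, take m p) = 0" unfolding path_elem_def by simp
      moreover have "(if m = length c then
          (if u = v \<and> take (length c) p = c then g (v, drop (length c) p) else 0) else 0) = 0"
        using False by presburger
      ultimately show ?thesis by (simp only: mult_zero_left)
    qed
    have "(g \<otimes>\<^bsub>?P\<^esub> path_elem v c) (u, p) = (\<Sum>m\<le>length p. if m = length c then
          (if u = v \<and> take (length c) p = c then g (v, drop (length c) p) else 0) else 0)"
      unfolding path_mult prod.case by (rule sum.cong) (use summand in auto)
    also have "\<dots> = (if u = v \<and> take (length c) p = c then g (v, drop (length c) p) else 0)"
      using take_all[of p "length c"] by (cases "length c \<le> length p") auto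
    finally have gc: "(g \<otimes>\<^bsub>?P\<^esub> path_elem v c) (u, p) =
      (if u = v \<and> take (length c) p = c then g (v, drop (length c) p) else 0)" .
    have pow: "(\<exists>m. p = concat (replicate m c)) \<longleftrightarrow> p = [] \<or>
      (take (length c) p = c \<and> (\<exists>m. drop (length c) p = concat (replicate m c)))"
    proof (intro iffI)
      assume "\<exists>m. p = concat (replicate m c)"
      then obtain m where m: "p = concat (replicate m c)" by blast
      then show "p = [] \<or>
          (take (length c) p = c \<and> (\<exists>m. drop (length c) p = concat (replicate m c)))"
        by (cases m) auto
    next
      assume "p = [] \<or>
          (take (length c) p = c \<and> (\<exists>m. drop (length c) p = concat (replicate m c)))"
      then show "\<exists>m. p = concat (replicate m c)"
      proof
        assume "p = []"
        then show ?thesis by (intro exI[of _ 0]) simp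
      next
        assume "take (length c) p = c \<and> (\<exists>m. drop (length c) p = concat (replicate m c))"
        then obtain m where "take (length c) p = c" "drop (length c) p = concat (replicate m c)"
          by blast
        then have "p = concat (replicate (Suc m) c)"
          by (metis append_take_drop_id concat.simps(2) replicate_Suc)
        then show ?thesis by blast
      qed
    qed
    show "g (u, p) = path_elem v [] (u, p) + (g \<otimes>\<^bsub>?P\<^esub> path_elem v c) (u, p)"
      unfolding gc using pow assms(2) by (auto simp: g_def path_elem_def)
  qed
  moreover have "act (\<lambda>\<pi>. path_elem v [] \<pi> + (g \<otimes>\<^bsub>?P\<^esub> path_elem v c) \<pi>) x =
      (\<lambda>w. act (path_elem v []) x w + act (g \<otimes>\<^bsub>?P\<^esub> path_elem v c) x w)"
    using v by (intro act_add x path_mult_closed g path_elem_carrier c) simp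
  moreover have "act (g \<otimes>\<^bsub>?P\<^esub> path_elem v c) x = act g (act (path_elem v c) x)"
    by (intro act_mult x g path_elem_carrier c)
  moreover have "act (path_elem v c) x = x"
    unfolding act_path[OF assms(1) x] weight by (auto simp: x_def)
  moreover have "act (path_elem v []) x = x"
    unfolding act_vertex[OF v x] by (auto simp: x_def)
  \<comment> \<open>Since \<open>c\<close> has weight zero, it fixes \<open>x\<close>, so the
    recursion makes the value 1 of \<open>x\<close> at \<open>v\<close> cancel.\<close>
  ultimately have "act g x v = x v + act g x v" by metis
  then show False by (simp add: x_def)
qed

text \<open>A walk with more arrows than the quiver repeats one, and the stretch from one occurrence
  up to the next is a cycle, which has positive weight.\<close>

lemma weight_pos:
  assumes "pre_digraph.awalk G u p v" "card (arcs G) < length p"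
  shows "weight S p \<noteq> 0"
proof -
  have "set p \<subseteq> arcs G" using assms(1) by (simp add: pre_digraph.awalk_def)
  then have "card (set p) < length p"
    using card_mono[OF finite_arcs, of "set p"] assms(2) by simp
  then have "\<not> distinct p" using distinct_card[of p] by auto
  then obtain xs ys zs a where p: "p = xs @ [a] @ ys @ [a] @ zs"
    using not_distinct_decomp by blast
  then obtain w where "pre_digraph.awalk G w ([a] @ ys @ [a] @ zs) v"
    using assms(1) by (auto simp only: awalk_append[OF heads])
  then have "pre_digraph.awalk G (tail G a) (a # ys) (tail G a)"
    unfolding append_Cons append_Nil awalk_Cons[OF heads] awalk_append[OF heads] by auto
  then have "weight S (a # ys) \<noteq> 0"
    using cycle_weight_pos by blast
  then show ?thesis by (auto simp: p split: if_splits)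
qed

text \<open>Each block of \<open>Suc (card (arcs G))\<close> consecutive arrows contributes at least
  one to the weight.\<close>

lemma weight_ge:
  assumes "pre_digraph.awalk G u p v" "d * Suc (card (arcs G)) \<le> length p"
  shows "d \<le> weight S p"
  using assms
proof (induction d arbitrary: u p)
  case (Suc d)
  let ?K = "Suc (card (arcs G))"
  obtain w where w: "pre_digraph.awalk G u (take ?K p) w" "pre_digraph.awalk G w (drop ?K p) v"
    using Suc.prems(1) awalk_append[OF heads, of u "take ?K p" "drop ?K p" v] by auto
  have "d \<le> weight S (drop ?K p)"
    using Suc.prems(2) by (intro Suc.IH[OF w(2)]) simp
  moreover have "weight S (take ?K p) \<noteq> 0"
    using Suc.prems(2) by (intro weight_pos[OF w(1)]) simp
  ultimately show ?case
    using weight_append[of S "take ?K p" "drop ?K p"] by simp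
qed simp

text \<open>The vertex set may be infinite, but only finitely many lists of arrows are short, and a
  list determines the start: the tail of its first arrow, or \<open>v\<close> itself if it is
  empty.\<close>

lemma finite_short_walks: "finite {(u, p). pre_digraph.awalk G u p v \<and> length p \<le> l}"
proof (rule finite_subset)
  show "{(u, p). pre_digraph.awalk G u p v \<and> length p \<le> l} \<subseteq>
      (\<lambda>p. (if p = [] then v else tail G (hd p), p)) ` {p. set p \<subseteq> arcs G \<and> length p \<le> l}"
  proof clarify
    fix u p assume "pre_digraph.awalk G u p v" "length p \<le> l"
    then show "(u, p) \<in> (\<lambda>p. (if p = [] then v else tail G (hd p), p)) `
        {p. set p \<subseteq> arcs G \<and> length p \<le> l}"
      by (intro image_eqI[of _ _ p]; cases p)
        (auto simp: pre_digraph.awalk_def pre_digraph.cas.simps)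
  qed
  show "finite ((\<lambda>p. (if p = [] then v else tail G (hd p), p)) `
      {p. set p \<subseteq> arcs G \<and> length p \<le> l})"
    by (intro finite_imageI finite_lists_length_le finite_arcs)
qed

text \<open>A path of length at least \<open>l\<close> splits uniquely into an initial part and a
  final segment \<open>q\<close> of length \<open>l\<close>; \<open>h (w, q)\<close> collects the
  coefficients of all paths with the same \<open>q\<close>. For fixed \<open>v\<close> there are
  finitely many \<open>q\<close>, so an infinite series becomes a finite sum to which additivity of
  an action applies.\<close>

lemma path_expansion:
  fixes f :: "('v, 'a) path_elt"
  assumes f: "f \<in> carrier (path_algebra G)" and v: "v \<in> verts G"
  defines "h \<equiv> \<lambda>(w, q) (u, p). if pre_digraph.awlast G u p = w then f (u, p @ q) else 0"
  shows "path_elem v [] \<otimes>\<^bsub>path_algebra G\<^esub> f = (\<lambda>\<pi>.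
      (\<Sum>(u, p)\<in>{(u, p). pre_digraph.awalk G u p v \<and> length p < l}. f (u, p) * path_elem u p \<pi>) +
      (\<Sum>(w, q)\<in>{(w, q). pre_digraph.awalk G w q v \<and> length q = l}.
        (path_elem w q \<otimes>\<^bsub>path_algebra G\<^esub> h (w, q)) \<pi>))"
    (is "_ = (\<lambda>\<pi>. (\<Sum>(u, p)\<in>?A. _ u p \<pi>) + (\<Sum>(w, q)\<in>?B. _ w q \<pi>))")
proof (rule ext, clarify)
  fix u :: 'v and r :: "'a list"
  \<comment> \<open>The cut at \<open>?k\<close> leaves a final segment of length \<open>l\<close>;
    if \<open>r\<close> is shorter, truncated subtraction gives 0 and the segment is too short to
    match.\<close>
  let ?P = "path_algebra G" and ?k = "length r - l"
  have finA: "finite ?A" and finB: "finite ?B"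
    by (rule finite_subset[OF _ finite_short_walks[of v l]]; force)+
  have "(\<Sum>(u', p)\<in>?A. f (u', p) * path_elem u' p (u, r)) =
      (\<Sum>\<pi>\<in>?A. if \<pi> = (u, r) then f (u, r) else 0)"
    by (rule sum.cong) (auto simp: path_elem_def split: if_splits)
  then have A: "(\<Sum>(u', p)\<in>?A. f (u', p) * path_elem u' p (u, r)) =
      (if (u, r) \<in> ?A then f (u, r) else 0)"
    by (simp only: sum.delta[OF finA])
  have "(path_elem w q \<otimes>\<^bsub>?P\<^esub> h (w, q)) (u, r) =
      (if (w, q) = (pre_digraph.awlast G u (take ?k r), drop ?k r) \<and> l \<le> length r
       then f (u, r) else 0)" if q: "length q = l" for w q
  proof -
    have "h (w, q) (u, take m r) * path_elem w q (pre_digraph.awlast G u (take m r), drop m r) =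
        (if m = ?k then (if (w, q) = (pre_digraph.awlast G u (take ?k r), drop ?k r)
          then f (u, r) else 0) else 0)" if "m \<le> length r" for m
    proof (cases "(w, q) = (pre_digraph.awlast G u (take m r), drop m r)")
      case True
      then have "m = ?k" using q that by auto
      then show ?thesis using True unfolding path_elem_def h_def by simp
    next
      case False
      then have "path_elem w q (pre_digraph.awlast G u (take m r), drop m r) = 0"
        unfolding path_elem_def by metis
      moreover have "(if m = ?k then (if (w, q) = (pre_digraph.awlast G u (take ?k r), drop ?k r)
          then f (u, r) else 0) else 0) = 0"
        using False by presburger
      ultimately show ?thesis by (simp only: mult_zero_right)
    qed
    then have "(path_elem w q \<otimes>\<^bsub>?P\<^esub> h (w, q)) (u, r) = (\<Sum>m\<le>length r.
        (if m = ?k then (if (w, q) = (pre_digraph.awlast G u (take ?k r), drop ?k r)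
          then f (u, r) else 0) else 0))"
      unfolding path_mult prod.case by (intro sum.cong) auto
    also have "\<dots> = (if (w, q) = (pre_digraph.awlast G u (take ?k r), drop ?k r)
          then f (u, r) else 0)"
      by simp
    also have "\<dots> = (if (w, q) = (pre_digraph.awlast G u (take ?k r), drop ?k r) \<and> l \<le> length r
       then f (u, r) else 0)"
      using q by auto
    finally show ?thesis .
  qed
  then have "(\<Sum>(w, q)\<in>?B. (path_elem w q \<otimes>\<^bsub>?P\<^esub> h (w, q)) (u, r)) =
      (\<Sum>\<pi>\<in>?B. if \<pi> = (pre_digraph.awlast G u (take ?k r), drop ?k r)
        then (if l \<le> length r then f (u, r) else 0) else 0)"
    by (intro sum.cong) (auto split: if_splits)
  then have B: "(\<Sum>(w, q)\<in>?B. (path_elem w q \<otimes>\<^bsub>?P\<^esub> h (w, q)) (u, r)) =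
      (if (pre_digraph.awlast G u (take ?k r), drop ?k r) \<in> ?B
        then (if l \<le> length r then f (u, r) else 0) else 0)"
    by (simp only: sum.delta[OF finB])
  have lhs: "(path_elem v [] \<otimes>\<^bsub>?P\<^esub> f) (u, r) = (if pre_digraph.awlast G u r = v then f (u, r) else 0)"
    by (simp add: path_elem_Nil vertex_mult_left)
  show "(path_elem v [] \<otimes>\<^bsub>?P\<^esub> f) (u, r) =
      (\<Sum>(u', p)\<in>?A. f (u', p) * path_elem u' p (u, r)) +
      (\<Sum>(w, q)\<in>?B. (path_elem w q \<otimes>\<^bsub>?P\<^esub> h (w, q)) (u, r))"
  proof (cases "(u, r) \<in> paths G")
    case False
    then show ?thesis
      using path_carrierD[OF f False] unfolding A B lhs by simp
  next
    case True
    have inA: "(u, r) \<in> ?A \<longleftrightarrow> pre_digraph.awlast G u r = v \<and> length r < l"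
      using True by (simp add: awalk_iff_paths)
    have "pre_digraph.awalk G u (take ?k r @ drop ?k r) (pre_digraph.awlast G u r)"
      using True by (simp add: in_paths_iff)
    then obtain w where w: "pre_digraph.awalk G u (take ?k r) w"
        "pre_digraph.awalk G w (drop ?k r) (pre_digraph.awlast G u r)"
      unfolding awalk_append[OF heads] by blast
    then have inB: "(pre_digraph.awlast G u (take ?k r), drop ?k r) \<in> ?B \<longleftrightarrow>
        pre_digraph.awlast G u r = v \<and> l \<le> length r"
      by (auto simp: awalk_iff_paths)
    show ?thesis
      unfolding A B lhs inA inB by auto
  qed
qed

text \<open>The coefficient of degree \<open>d\<close> is isolated by splitting off the paths so
  long that their weight exceeds \<open>d\<close>. What remains is a finite combination of paths, on
  which the action is prescribed by the arrows.\<close>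

lemma act_eq_weight_action_vertex:
  assumes f: "f \<in> carrier (path_algebra G)" and x: "x \<in> V" and v: "v \<in> verts G"
  shows "act f x v = weight_action G S f x v"
proof (rule fps_ext)
  fix d
  let ?P = "path_algebra G"
  \<comment> \<open>By \<open>weight_ge\<close>, every walk of length \<open>l\<close> has weight at
    least \<open>Suc d\<close>.\<close>
  define l where "l = Suc d * Suc (card (arcs G))"
  let ?A = "{(u, p). pre_digraph.awalk G u p v \<and> length p < l}"
  let ?B = "{(w, q). pre_digraph.awalk G w q v \<and> length q = l}"
  define h where "h = (\<lambda>(w, q) (u, p). if pre_digraph.awlast G u p = w then f (u, p @ q) else 0)"
  have finA: "finite ?A" and finB: "finite ?B"
    by (rule finite_subset[OF _ finite_short_walks[of v l]]; force)+
  have h: "h (w, q) \<in> carrier ?P" for w q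
  proof (rule path_carrierI)
    fix u p assume "(u, p) \<notin> paths G"
    then have "(u, p @ q) \<notin> paths G"
      using take_in_paths[of u "p @ q" G "length p"] by auto
    then show "h (w, q) (u, p) = 0"
      using path_carrierD[OF f] by (simp add: h_def)
  qed
  have pA: "(\<lambda>\<pi>'. f \<pi> * path_elem (fst \<pi>) (snd \<pi>) \<pi>') \<in> carrier ?P"
    and pA': "path_elem (fst \<pi>) (snd \<pi>) \<in> carrier ?P" if "\<pi> \<in> ?A" for \<pi>
    using that by (auto simp: path_carrier path_elem_def paths_def)
  have pB: "path_elem (fst \<pi>) (snd \<pi>) \<in> carrier ?P" if "\<pi> \<in> ?B" for \<pi>
    using that by (auto simp: paths_def intro!: path_elem_carrier)
  have pB': "path_elem (fst \<pi>) (snd \<pi>) \<otimes>\<^bsub>?P\<^esub> h \<pi> \<in> carrier ?P" if "\<pi> \<in> ?B" for \<pi>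
    using path_mult_closed[OF pB[OF that]] h by (cases \<pi>) auto
  have sums: "(\<lambda>\<pi>'. \<Sum>\<pi>\<in>?A. f \<pi> * path_elem (fst \<pi>) (snd \<pi>) \<pi>') \<in> carrier ?P"
    "(\<lambda>\<pi>'. \<Sum>\<pi>\<in>?B. (path_elem (fst \<pi>) (snd \<pi>) \<otimes>\<^bsub>?P\<^esub> h \<pi>) \<pi>') \<in> carrier ?P"
    using path_carrierD[OF pA] path_carrierD[OF pB']
    by (auto intro!: path_carrierI sum.neutral simp del: mult_eq_0_iff)
  \<comment> \<open>The idempotent at \<open>v\<close> does not change this component and restricts
    the series to paths ending at \<open>v\<close>.\<close>
  have "act f x v = act (path_elem v []) (act f x) v"
    using act_vertex[OF v act_closed[OF f x]] by simp
  also have "\<dots> = act (path_elem v [] \<otimes>\<^bsub>?P\<^esub> f) x v"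
    using act_mult[OF path_elem_carrier f x, of v "[]"] v by simp
  also have "path_elem v [] \<otimes>\<^bsub>?P\<^esub> f =
      (\<lambda>\<pi>'. (\<Sum>\<pi>\<in>?A. f \<pi> * path_elem (fst \<pi>) (snd \<pi>) \<pi>') +
        (\<Sum>\<pi>\<in>?B. (path_elem (fst \<pi>) (snd \<pi>) \<otimes>\<^bsub>?P\<^esub> h \<pi>) \<pi>'))"
    using path_expansion[OF f v, of l] by (simp add: h_def split_def cong: if_cong)
  also have "act \<dots> x v =
      act (\<lambda>\<pi>'. \<Sum>\<pi>\<in>?A. f \<pi> * path_elem (fst \<pi>) (snd \<pi>) \<pi>') x v +
      act (\<lambda>\<pi>'. \<Sum>\<pi>\<in>?B. (path_elem (fst \<pi>) (snd \<pi>) \<otimes>\<^bsub>?P\<^esub> h \<pi>) \<pi>') x v"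
    using act_add[OF sums x] by simp
  also have "\<dots> =
      (\<Sum>\<pi>\<in>?A. act (\<lambda>\<pi>'. f \<pi> * path_elem (fst \<pi>) (snd \<pi>) \<pi>') x v) +
      (\<Sum>\<pi>\<in>?B. act (path_elem (fst \<pi>) (snd \<pi>) \<otimes>\<^bsub>?P\<^esub> h \<pi>) x v)"
    using act_sum[OF finA pA x] act_sum[OF finB pB' x] by simp
  also have "(\<Sum>\<pi>\<in>?A. act (\<lambda>\<pi>'. f \<pi> * path_elem (fst \<pi>) (snd \<pi>) \<pi>') x v) =
      (\<Sum>(u, p)\<in>?A. fps_const (f (u, p)) * (fps_X ^ weight S p * x u))"
    using act_smult[OF pA' x] act_path[OF _ x] by (intro sum.cong) auto
  also have "(\<Sum>\<pi>\<in>?B. act (path_elem (fst \<pi>) (snd \<pi>) \<otimes>\<^bsub>?P\<^esub> h \<pi>) x v) =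
      (\<Sum>(w, q)\<in>?B. fps_X ^ weight S q * act (h (w, q)) x w)"
  proof (rule sum.cong)
    fix \<pi> assume \<pi>: "\<pi> \<in> ?B"
    obtain w q where wq: "\<pi> = (w, q)" by fastforce
    show "act (path_elem (fst \<pi>) (snd \<pi>) \<otimes>\<^bsub>?P\<^esub> h \<pi>) x v =
        (case \<pi> of (w, q) \<Rightarrow> fps_X ^ weight S q * act (h (w, q)) x w)"
      using act_mult[OF pB[OF \<pi>] h[of w q] x] act_path[of w q v "act (h (w, q)) x"]
        act_closed[OF h x] \<pi> wq by simp
  qed simp
  finally have act: "act f x v =
      (\<Sum>(u, p)\<in>?A. fps_const (f (u, p)) * (fps_X ^ weight S p * x u)) +
      (\<Sum>(w, q)\<in>?B. fps_X ^ weight S q * act (h (w, q)) x w)" .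
  \<comment> \<open>However \<open>h (w, q)\<close> acts, the path \<open>q\<close> applied
    afterwards multiplies the result by a power of t beyond degree \<open>d\<close>.\<close>
  have B0: "fps_nth (\<Sum>(w, q)\<in>?B. fps_X ^ weight S q * act (h (w, q)) x w) d = 0"
    unfolding fps_sum_nth
  proof (rule sum.neutral, clarify)
    fix w q assume "pre_digraph.awalk G w q v" "l = length q"
    then have "Suc d \<le> weight S q" using weight_ge[of w q v "Suc d"] by (simp add: l_def)
    then show "fps_nth (fps_X ^ weight S q * act (h (w, q)) x w) d = 0"
      by (simp add: fps_X_power_mult_nth)
  qed
  let ?W = "{(u, p). pre_digraph.awalk G u p v \<and> weight S p \<le> d}"
  \<comment> \<open>Paths of weight at most \<open>d\<close> are short, so the index set in
    \<open>weight_action\<close> is finite; the other short paths do not reach the coefficient of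
    degree \<open>d\<close>.\<close>
  have W: "?W \<subseteq> ?A"
  proof clarify
    fix u p assume p: "pre_digraph.awalk G u p v" "weight S p \<le> d"
    then show "length p < l"
      using weight_ge[OF p(1), of "Suc d"] by (force simp: l_def not_le)
  qed
  have "fps_nth (act f x v) d =
      (\<Sum>(u, p)\<in>?A. f (u, p) * fps_nth (fps_X ^ weight S p * x u) d)"
    unfolding act fps_add_nth B0 by (simp add: fps_sum_nth split_def)
  also have "\<dots> = (\<Sum>(u, p)\<in>?W. f (u, p) * fps_nth (fps_X ^ weight S p * x u) d)"
    using finA W
    by (intro sum.mono_neutral_right) (auto simp: fps_X_power_mult_nth split: if_splits)
  also have "\<dots> = (\<Sum>(u, p)\<in>?W. f (u, p) * fps_nth (x u) (d - weight S p))"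
    by (intro sum.cong) (auto simp: fps_X_power_mult_nth)
  also have "\<dots> = fps_nth (weight_action G S f x v) d"
    by (simp add: weight_action_def)
  finally show "fps_nth (act f x v) d = fps_nth (weight_action G S f x v) d" .
qed

theorem act_eq_weight_action:
  assumes f: "f \<in> carrier (path_algebra G)" and x: "x \<in> V"
  shows "act f x = weight_action G S f x"
proof
  fix v
  show "act f x v = weight_action G S f x v"
  proof (cases "v \<in> verts G")
    case True
    then show ?thesis by (rule act_eq_weight_action_vertex[OF f x])
  next
    case False
    then have "{(u, p). pre_digraph.awalk G u p v \<and> weight S p \<le> d} = {}" for d
      using awalk_end_in_verts[OF heads] by blast
    then have "weight_action G S f x v = Abs_fps (\<lambda>_. 0)"
      unfolding weight_action_def by (simp only: sum.empty)
    then show ?thesis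
      using act_closed[OF f x] False by (simp add: V_eq fps_zero_def)
  qed
qed

end

section \<open>Power series in an element without constant term\<close>

lemma path_pow_carrier:
  assumes "ring (path_algebra G)" "T \<in> carrier (path_algebra G)"
  shows "T [^]\<^bsub>path_algebra G\<^esub> (m::nat) \<in> carrier (path_algebra G)"
proof -
  interpret ring "path_algebra G" by fact
  show ?thesis using assms(2) by simp
qed

text \<open>Every factor \<open>T\<close> uses up at least one arrow. Hence the truncation at the
  length of the path in \<open>power_series_elem\<close> omits only zero terms.\<close>

lemma path_pow_eq_0:
  fixes m :: nat
  assumes "\<And>u. T (u, []) = 0" "length p < m"
  shows "(T [^]\<^bsub>path_algebra G\<^esub> m) (u, p) = 0"
  using assms(2)
proof (induction m arbitrary: u p)
  case (Suc m)
  have "T (u, take j p) * (T [^]\<^bsub>path_algebra G\<^esub> m) (pre_digraph.awlast G u (take j p), drop j p) = 0"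
    for j
  proof (cases "j = 0 \<or> p = []")
    case False
    then have "length (drop j p) < m" using Suc.prems by (cases p) auto
    then show ?thesis using Suc.IH by simp
  qed (auto simp: assms(1))
  then show ?case by (simp only: nat_pow_Suc path_mult prod.case sum.neutral_const)
qed simp

lemma power_series_elem_carrier:
  assumes "ring (path_algebra G)" "T \<in> carrier (path_algebra G)"
  shows "power_series_elem G T f \<in> carrier (path_algebra G)"
  using path_carrierD[OF path_pow_carrier[OF assms]]
  by (intro path_carrierI) (simp add: power_series_elem_def)

text \<open>Horner's rule f = f(0) + t g, with g the shifted series. It expresses an infinite series
  by one multiplication and one addition, operations that an action respects.\<close>

lemma power_series_elem_rec:
  assumes P: "ring (path_algebra G)" and T: "T \<in> carrier (path_algebra G)" "\<And>u. T (u, []) = 0"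
  shows "power_series_elem G T f = (\<lambda>\<pi>. scalar_elem G (fps_nth f 0) \<pi> +
    (T \<otimes>\<^bsub>path_algebra G\<^esub> power_series_elem G T (fps_shift 1 f)) \<pi>)"
proof (rule ext, clarify)
  fix u p
  let ?P = "path_algebra G"
  interpret ring ?P by fact
  let ?a = "\<lambda>j. pre_digraph.awlast G u (take j p)"
  have "(T \<otimes>\<^bsub>?P\<^esub> power_series_elem G T (fps_shift 1 f)) (u, p) =
      (\<Sum>j\<le>length p. \<Sum>m\<le>length p.
        fps_nth f (Suc m) * ((T [^]\<^bsub>?P\<^esub> m) (u, take j p) * T (?a j, drop j p)))"
    unfolding path_mult prod.case
  proof (rule sum.cong)
    fix j assume j: "j \<in> {..length p}"
    have "power_series_elem G T (fps_shift 1 f) (u, take j p) =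
        (\<Sum>m\<le>j. fps_nth f (Suc m) * (T [^]\<^bsub>?P\<^esub> m) (u, take j p))"
      using j by (simp add: power_series_elem_def min_absorb2)
    \<comment> \<open>The range may be enlarged to a bound free of \<open>j\<close>, as the added
      powers vanish on so short a path; then the sums can be exchanged.\<close>
    also have "\<dots> = (\<Sum>m\<le>length p. fps_nth f (Suc m) * (T [^]\<^bsub>?P\<^esub> m) (u, take j p))"
      using j by (intro sum.mono_neutral_left) (auto simp: path_pow_eq_0[where T = T, OF T(2)])
    finally show "power_series_elem G T (fps_shift 1 f) (u, take j p) * T (?a j, drop j p) =
      (\<Sum>m\<le>length p. fps_nth f (Suc m) * ((T [^]\<^bsub>?P\<^esub> m) (u, take j p) * T (?a j, drop j p)))"
      by (simp add: sum_distrib_right mult.assoc)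
  qed simp
  also have "\<dots> = (\<Sum>m\<le>length p. fps_nth f (Suc m) * (T \<otimes>\<^bsub>?P\<^esub> T [^]\<^bsub>?P\<^esub> m) (u, p))"
    unfolding path_mult prod.case sum_distrib_left by (rule sum.swap)
  also have "\<dots> = (\<Sum>m\<le>length p. fps_nth f (Suc m) * (T [^]\<^bsub>?P\<^esub> Suc m) (u, p))"
    using T(1) by (simp only: nat_pow_Suc2)
  finally have "scalar_elem G (fps_nth f 0) (u, p) +
      (T \<otimes>\<^bsub>?P\<^esub> power_series_elem G T (fps_shift 1 f)) (u, p) =
      fps_nth f 0 * (T [^]\<^bsub>?P\<^esub> (0::nat)) (u, p) +
        (\<Sum>m\<le>length p. fps_nth f (Suc m) * (T [^]\<^bsub>?P\<^esub> Suc m) (u, p))"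
    by (simp only: nat_pow_0) (simp add: scalar_elem_def path_one)
  also have "\<dots> = (\<Sum>m\<le>Suc (length p). fps_nth f m * (T [^]\<^bsub>?P\<^esub> m) (u, p))"
    by (simp only: sum.atMost_Suc_shift)
  also have "\<dots> = (\<Sum>m\<le>length p. fps_nth f m * (T [^]\<^bsub>?P\<^esub> m) (u, p))"
    by (simp only: sum.atMost_Suc path_pow_eq_0[where T = T, OF T(2)] lessI) simp
  also have "\<dots> = power_series_elem G T f (u, p)"
    by (simp only: power_series_elem_def snd_conv)
  finally show "power_series_elem G T f (u, p) = scalar_elem G (fps_nth f 0) (u, p) +
      (T \<otimes>\<^bsub>?P\<^esub> power_series_elem G T (fps_shift 1 f)) (u, p)" by (rule sym)
qed

text \<open>Each use of the recursion gains a factor t, which allows induction on the degree for all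
  \<open>f\<close> at once. Only the component at \<open>w\<close> is followed, because
  \<open>dimer_t\<close> is evaluated only at boundary vertices.\<close>

lemma (in power_series_rep) act_power_series:
  assumes T: "T \<in> carrier (path_algebra G)" "\<And>u. T (u, []) = 0"
    and act_T: "\<And>x. x \<in> V \<Longrightarrow> act T x w = fps_X * x w"
    and x: "x \<in> V"
  shows "act (power_series_elem G T f) x w = f * x w"
proof (rule fps_ext)
  fix d
  note P = ring_path_algebra[OF heads]
  note pse = power_series_elem_carrier[OF P T(1)]
  have rec: "act (power_series_elem G T f) x w = fps_const (fps_nth f 0) * x w +
      fps_X * act (power_series_elem G T (fps_shift 1 f)) x w" for f
    using power_series_elem_rec[OF P T, of f] act_scalar[OF x] act_T[OF act_closed[OF pse x]]
    by (simp add: act_add[OF scalar_elem_carrier path_mult_closed[OF T(1) pse] x]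
        act_mult[OF T(1) pse x])
  have "f = fps_const (fps_nth f 0) + fps_X * fps_shift 1 f" for f :: "complex fps"
    by (rule fps_ext) (simp add: fps_X_mult_nth)
  then have rec': "f * x w = fps_const (fps_nth f 0) * x w + fps_X * (fps_shift 1 f * x w)"
    for f by (metis distrib_right mult.assoc)
  show "fps_nth (act (power_series_elem G T f) x w) d = fps_nth (f * x w) d"
  proof (induction d arbitrary: f)
    case 0
    show ?case unfolding rec[of f] rec'[of f] by simp
  next
    case (Suc d)
    show ?case unfolding rec[of f] rec'[of f] by (simp add: Suc.IH fps_X_mult_nth)
  qed
qed

section \<open>Corner rings and modules\<close>

lemma corner_sel:
  shows corner_ring_carrier: "carrier (corner_ring R e) = {e \<otimes>\<^bsub>R\<^esub> a \<otimes>\<^bsub>R\<^esub> e | a. a \<in> carrier R}"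
    and corner_ring_mult: "monoid.mult (corner_ring R e) = monoid.mult R"
    and corner_ring_one: "one (corner_ring R e) = e"
    and corner_ring_zero: "ring.zero (corner_ring R e) = ring.zero R"
    and corner_ring_add: "ring.add (corner_ring R e) = ring.add R"
    and corner_module_carrier: "carrier (corner_module e M) = {e \<odot>\<^bsub>M\<^esub> x | x. x \<in> carrier M}"
    and corner_module_zero: "ring.zero (corner_module e M) = ring.zero M"
    and corner_module_add: "ring.add (corner_module e M) = ring.add M"
    and corner_module_smult: "smult (corner_module e M) = smult M"
  by (simp_all add: corner_ring_def corner_module_def)

lemma ring_corner_ring:
  assumes "ring R" and e: "e \<in> carrier R" "e \<otimes>\<^bsub>R\<^esub> e = e"
  shows "ring (corner_ring R e)"
proof -
  interpret ring R by fact
  \<comment> \<open>Members of \<open>e R e\<close> are exactly the elements of \<open>R\<close>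
    fixed by \<open>e\<close> on both sides; this and its converse \<open>mem\<close> reduce closure
    to computations in \<open>R\<close>.\<close>
  have closed: "x \<in> carrier R" and left: "e \<otimes>\<^bsub>R\<^esub> x = x" and right: "x \<otimes>\<^bsub>R\<^esub> e = x"
    if x: "x \<in> carrier (corner_ring R e)" for x
  proof -
    obtain a where a: "a \<in> carrier R" "x = e \<otimes>\<^bsub>R\<^esub> a \<otimes>\<^bsub>R\<^esub> e"
      using x by (auto simp: corner_sel)
    then show "x \<in> carrier R" using e by simp
    have "e \<otimes>\<^bsub>R\<^esub> x = (e \<otimes>\<^bsub>R\<^esub> e) \<otimes>\<^bsub>R\<^esub> a \<otimes>\<^bsub>R\<^esub> e" using a e(1) by (simp add: m_assoc)
    then show "e \<otimes>\<^bsub>R\<^esub> x = x" using a e by simp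
    have "x \<otimes>\<^bsub>R\<^esub> e = e \<otimes>\<^bsub>R\<^esub> a \<otimes>\<^bsub>R\<^esub> (e \<otimes>\<^bsub>R\<^esub> e)" using a e(1) by (simp add: m_assoc)
    then show "x \<otimes>\<^bsub>R\<^esub> e = x" using a e by simp
  qed
  have mem: "x \<in> carrier (corner_ring R e)" if "x \<in> carrier R" "e \<otimes>\<^bsub>R\<^esub> x = x" "x \<otimes>\<^bsub>R\<^esub> e = x" for x
    using that by (auto simp: corner_sel intro!: exI[of _ x])
  show ?thesis
  proof (rule ringI)
    show "abelian_group (corner_ring R e)"
    proof (rule abelian_groupI)
      fix x y z
      assume x: "x \<in> carrier (corner_ring R e)" and y: "y \<in> carrier (corner_ring R e)"
      show "x \<oplus>\<^bsub>corner_ring R e\<^esub> y \<in> carrier (corner_ring R e)"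
        using closed left right x y e
        by (intro mem) (simp_all add: corner_ring_add r_distr l_distr)
      assume z: "z \<in> carrier (corner_ring R e)"
      show "x \<oplus>\<^bsub>corner_ring R e\<^esub> y \<oplus>\<^bsub>corner_ring R e\<^esub> z =
          x \<oplus>\<^bsub>corner_ring R e\<^esub> (y \<oplus>\<^bsub>corner_ring R e\<^esub> z)"
        using closed x y z by (simp add: corner_ring_add a_assoc)
      show "x \<oplus>\<^bsub>corner_ring R e\<^esub> y = y \<oplus>\<^bsub>corner_ring R e\<^esub> x"
        using closed x y by (simp add: corner_ring_add a_comm)
    next
      show "\<zero>\<^bsub>corner_ring R e\<^esub> \<in> carrier (corner_ring R e)"
        using e by (intro mem) (simp_all add: corner_ring_zero)
    next
      fix x assume x: "x \<in> carrier (corner_ring R e)"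
      show "\<zero>\<^bsub>corner_ring R e\<^esub> \<oplus>\<^bsub>corner_ring R e\<^esub> x = x"
        using closed x by (simp add: corner_ring_zero corner_ring_add)
      have "\<ominus>\<^bsub>R\<^esub> x \<in> carrier (corner_ring R e)"
        using closed left right x e by (intro mem) (simp_all add: r_minus l_minus)
      then show "\<exists>y\<in>carrier (corner_ring R e). y \<oplus>\<^bsub>corner_ring R e\<^esub> x = \<zero>\<^bsub>corner_ring R e\<^esub>"
        using closed x l_neg by (auto simp: corner_ring_zero corner_ring_add)
    qed
    show "monoid (corner_ring R e)"
    proof (rule monoidI)
      show "\<one>\<^bsub>corner_ring R e\<^esub> \<in> carrier (corner_ring R e)"
        using e by (intro mem) (simp_all add: corner_ring_one)
    next
      fix x y assume x: "x \<in> carrier (corner_ring R e)" and y: "y \<in> carrier (corner_ring R e)"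
      have "e \<otimes>\<^bsub>R\<^esub> (x \<otimes>\<^bsub>R\<^esub> y) = x \<otimes>\<^bsub>R\<^esub> y" "x \<otimes>\<^bsub>R\<^esub> y \<otimes>\<^bsub>R\<^esub> e = x \<otimes>\<^bsub>R\<^esub> y"
        using closed[OF x] closed[OF y] left[OF x] right[OF y] e
        by (simp_all add: m_assoc[symmetric]) (simp add: m_assoc)
      then show "x \<otimes>\<^bsub>corner_ring R e\<^esub> y \<in> carrier (corner_ring R e)"
        using closed x y by (intro mem) (simp_all add: corner_ring_mult)
    qed (use closed left right in \<open>simp_all add: corner_ring_mult corner_ring_one m_assoc\<close>)
  qed (use closed in \<open>simp_all add: corner_ring_mult corner_ring_add l_distr r_distr\<close>)
qed

lemma (in left_module) smult_zero_left:
  assumes "x \<in> carrier M"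
  shows "\<zero>\<^bsub>R\<^esub> \<odot>\<^bsub>M\<^esub> x = \<zero>\<^bsub>M\<^esub>"
proof -
  have "\<zero>\<^bsub>R\<^esub> \<odot>\<^bsub>M\<^esub> x \<oplus>\<^bsub>M\<^esub> \<zero>\<^bsub>R\<^esub> \<odot>\<^bsub>M\<^esub> x = \<zero>\<^bsub>R\<^esub> \<odot>\<^bsub>M\<^esub> x"
    using smult_l_distr[of "\<zero>\<^bsub>R\<^esub>" "\<zero>\<^bsub>R\<^esub>" x] assms by simp
  then show ?thesis
    using smult_closed[of "\<zero>\<^bsub>R\<^esub>" x] assms by (simp add: M.add.r_cancel_one)
qed

lemma (in left_module) smult_zero_right:
  assumes "a \<in> carrier R"
  shows "a \<odot>\<^bsub>M\<^esub> \<zero>\<^bsub>M\<^esub> = \<zero>\<^bsub>M\<^esub>"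
proof -
  have "a \<odot>\<^bsub>M\<^esub> \<zero>\<^bsub>M\<^esub> \<oplus>\<^bsub>M\<^esub> a \<odot>\<^bsub>M\<^esub> \<zero>\<^bsub>M\<^esub> = a \<odot>\<^bsub>M\<^esub> \<zero>\<^bsub>M\<^esub>"
    using smult_r_distr[of a "\<zero>\<^bsub>M\<^esub>" "\<zero>\<^bsub>M\<^esub>"] assms by simp
  then show ?thesis
    using smult_closed[of a "\<zero>\<^bsub>M\<^esub>"] assms by (simp add: M.add.r_cancel_one)
qed

lemma left_module_corner:
  fixes M :: "('r, 'm) module"
  assumes "left_module R M" and e: "e \<in> carrier R" "e \<otimes>\<^bsub>R\<^esub> e = e"
  shows "left_module (corner_ring R e) (corner_module e M)"
proof -
  interpret left_module R M by fact
  interpret C: ring "corner_ring R e" by (rule ring_corner_ring[OF R.ring_axioms e])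
  have closed: "x \<in> carrier M" and fixed: "e \<odot>\<^bsub>M\<^esub> x = x" if "x \<in> carrier (corner_module e M)" for x
    using that e smult_closed smult_assoc[of e e, symmetric] by (auto simp: corner_sel)
  have mem: "x \<in> carrier (corner_module e M)" if "x \<in> carrier M" "e \<odot>\<^bsub>M\<^esub> x = x" for x
    using that by (auto simp: corner_sel intro!: exI[of _ x])
  have rclosed: "a \<in> carrier R" and rfixed: "e \<otimes>\<^bsub>R\<^esub> a = a" if "a \<in> carrier (corner_ring R e)" for a
    using that e C.l_one[OF that] by (auto simp: corner_ring_carrier corner_ring_one corner_ring_mult)
  show ?thesis
  proof (intro left_module.intro left_module_axioms.intro)
    show "ring (corner_ring R e)" by (rule C.ring_axioms)
    show "abelian_group (corner_module e M)"
    proof (rule abelian_groupI)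
      fix x y z
      assume x: "x \<in> carrier (corner_module e M)" and y: "y \<in> carrier (corner_module e M)"
      show "x \<oplus>\<^bsub>corner_module e M\<^esub> y \<in> carrier (corner_module e M)"
        using closed fixed x y e by (intro mem) (simp_all add: corner_module_add smult_r_distr)
      assume z: "z \<in> carrier (corner_module e M)"
      show "x \<oplus>\<^bsub>corner_module e M\<^esub> y \<oplus>\<^bsub>corner_module e M\<^esub> z =
          x \<oplus>\<^bsub>corner_module e M\<^esub> (y \<oplus>\<^bsub>corner_module e M\<^esub> z)"
        using closed x y z by (simp add: corner_module_add M.a_assoc)
      show "x \<oplus>\<^bsub>corner_module e M\<^esub> y = y \<oplus>\<^bsub>corner_module e M\<^esub> x"
        using closed x y by (simp add: corner_module_add M.a_comm)
    next
      show "\<zero>\<^bsub>corner_module e M\<^esub> \<in> carrier (corner_module e M)"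
        using e by (intro mem) (simp_all add: corner_module_zero smult_zero_right)
    next
      fix x assume x: "x \<in> carrier (corner_module e M)"
      show "\<zero>\<^bsub>corner_module e M\<^esub> \<oplus>\<^bsub>corner_module e M\<^esub> x = x"
        using closed x by (simp add: corner_module_zero corner_module_add)
      have "e \<odot>\<^bsub>M\<^esub> (\<ominus>\<^bsub>M\<^esub> x) \<oplus>\<^bsub>M\<^esub> x = e \<odot>\<^bsub>M\<^esub> (\<ominus>\<^bsub>M\<^esub> x) \<oplus>\<^bsub>M\<^esub> e \<odot>\<^bsub>M\<^esub> x"
        using fixed[OF x] by simp
      also have "\<dots> = \<zero>\<^bsub>M\<^esub>"
        using closed[OF x] e
        by (simp add: smult_r_distr[symmetric] M.l_neg smult_zero_right)
      finally have "e \<odot>\<^bsub>M\<^esub> (\<ominus>\<^bsub>M\<^esub> x) \<oplus>\<^bsub>M\<^esub> x = \<zero>\<^bsub>M\<^esub>" .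
      moreover have "e \<odot>\<^bsub>M\<^esub> (\<ominus>\<^bsub>M\<^esub> x) \<in> carrier (corner_module e M)"
        using closed[OF x] by (auto simp: corner_module_carrier)
      ultimately show "\<exists>y\<in>carrier (corner_module e M).
          y \<oplus>\<^bsub>corner_module e M\<^esub> x = \<zero>\<^bsub>corner_module e M\<^esub>"
        by (auto simp: corner_module_zero corner_module_add)
    qed
  next
    fix a x assume a: "a \<in> carrier (corner_ring R e)" and x: "x \<in> carrier (corner_module e M)"
    show "a \<odot>\<^bsub>corner_module e M\<^esub> x \<in> carrier (corner_module e M)"
      using closed[OF x] rclosed[OF a] rfixed[OF a] e smult_closed smult_assoc[of e a x]
      by (intro mem) (simp_all add: corner_module_smult)
  qed (use closed fixed rclosed in \<open>simp_all add: corner_module_smult corner_module_add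
      corner_ring_add corner_ring_mult corner_ring_one smult_l_distr smult_r_distr smult_assoc\<close>)
qed

section \<open>Restriction of scalars, transport of structure and free modules\<close>

lemma restrict_scalars_sel:
  shows restrict_scalars_carrier: "carrier (restrict_scalars \<epsilon> M) = carrier M"
    and restrict_scalars_zero: "ring.zero (restrict_scalars \<epsilon> M) = ring.zero M"
    and restrict_scalars_add: "ring.add (restrict_scalars \<epsilon> M) = ring.add M"
    and restrict_scalars_smult: "smult (restrict_scalars \<epsilon> M) = (\<lambda>a x. smult M (\<epsilon> a) x)"
  by (simp_all add: restrict_scalars_def)

lemma left_module_restrict:
  assumes "left_module R M" "ring R'" "\<epsilon> \<in> ring_hom R' R"
  shows "left_module R' (restrict_scalars \<epsilon> M)"
proof -
  interpret left_module R M by fact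
  have "abelian_group (restrict_scalars \<epsilon> M)"
    by (rule abelian_groupI)
      (auto simp: restrict_scalars_sel M.a_ac M.l_neg intro!: bexI[of _ "\<ominus>\<^bsub>M\<^esub> _"])
  then show ?thesis
    using assms(2)
    by (intro left_module.intro left_module_axioms.intro)
      (simp_all add: restrict_scalars_sel smult_closed smult_l_distr smult_r_distr smult_assoc
        smult_one ring_hom_closed[OF assms(3)] ring_hom_add[OF assms(3)] ring_hom_mult[OF assms(3)]
        ring_hom_one[OF assms(3)])
qed

text \<open>Transport of structure: every axiom for \<open>L\<close> is pulled back along the
  bijection. In this way \<open>subset_module\<close> becomes a C-module without a direct check that
  the relations of C hold on it.\<close>

lemma left_module_isoI:
  assumes "left_module R M"
    and bij: "bij_betw \<phi> (carrier M) (carrier L)"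
    and zero_eq: "\<phi> \<zero>\<^bsub>M\<^esub> = \<zero>\<^bsub>L\<^esub>"
    and add_eq: "\<And>x y. x \<in> carrier M \<Longrightarrow> y \<in> carrier M \<Longrightarrow> \<phi> (x \<oplus>\<^bsub>M\<^esub> y) = \<phi> x \<oplus>\<^bsub>L\<^esub> \<phi> y"
    and smult_eq: "\<And>a x. a \<in> carrier R \<Longrightarrow> x \<in> carrier M \<Longrightarrow> \<phi> (a \<odot>\<^bsub>M\<^esub> x) = a \<odot>\<^bsub>L\<^esub> \<phi> x"
  shows "left_module_iso R M L \<phi>"
proof -
  interpret left_module R M by fact
  have mem: "\<phi> x \<in> carrier L" if "x \<in> carrier M" for x
    using bij that by (auto simp: bij_betw_def)
  have ex: "\<exists>x\<in>carrier M. y = \<phi> x" if "y \<in> carrier L" for y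
    using bij that by (auto simp: bij_betw_def)
  note add_eq = add_eq[symmetric] and smult_eq = smult_eq[symmetric]
  have "abelian_group L"
  proof (rule abelian_groupI)
    show "\<zero>\<^bsub>L\<^esub> \<in> carrier L" using mem zero_eq M.zero_closed by metis
    fix x assume "x \<in> carrier L"
    then obtain x' where x: "x' \<in> carrier M" "x = \<phi> x'" using ex by blast
    show "\<zero>\<^bsub>L\<^esub> \<oplus>\<^bsub>L\<^esub> x = x"
      using x by (simp add: zero_eq[symmetric] add_eq)
    have "\<phi> (\<ominus>\<^bsub>M\<^esub> x') \<oplus>\<^bsub>L\<^esub> x = \<zero>\<^bsub>L\<^esub>"
      using x by (simp add: zero_eq[symmetric] add_eq M.l_neg)
    then show "\<exists>y\<in>carrier L. y \<oplus>\<^bsub>L\<^esub> x = \<zero>\<^bsub>L\<^esub>"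
      using mem x by blast
    fix y assume "y \<in> carrier L"
    then obtain y' where y: "y' \<in> carrier M" "y = \<phi> y'" using ex by blast
    show "x \<oplus>\<^bsub>L\<^esub> y \<in> carrier L" using x y mem by (simp add: add_eq)
    show "x \<oplus>\<^bsub>L\<^esub> y = y \<oplus>\<^bsub>L\<^esub> x" using x y by (simp add: add_eq M.a_comm)
    fix z assume "z \<in> carrier L"
    then obtain z' where z: "z' \<in> carrier M" "z = \<phi> z'" using ex by blast
    show "x \<oplus>\<^bsub>L\<^esub> y \<oplus>\<^bsub>L\<^esub> z = x \<oplus>\<^bsub>L\<^esub> (y \<oplus>\<^bsub>L\<^esub> z)"
      using x y z by (simp add: add_eq M.a_assoc)
  qed
  moreover have "left_module_axioms R L"
  proof
    fix a x assume a: "a \<in> carrier R" and "x \<in> carrier L"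
    then obtain x' where x: "x' \<in> carrier M" "x = \<phi> x'" using ex by blast
    show "a \<odot>\<^bsub>L\<^esub> x \<in> carrier L" using a x mem smult_closed by (simp add: smult_eq)
    fix b assume b: "b \<in> carrier R"
    show "(a \<oplus>\<^bsub>R\<^esub> b) \<odot>\<^bsub>L\<^esub> x = a \<odot>\<^bsub>L\<^esub> x \<oplus>\<^bsub>L\<^esub> b \<odot>\<^bsub>L\<^esub> x"
      using a b x smult_closed by (simp add: smult_eq add_eq smult_l_distr)
    show "a \<otimes>\<^bsub>R\<^esub> b \<odot>\<^bsub>L\<^esub> x = a \<odot>\<^bsub>L\<^esub> (b \<odot>\<^bsub>L\<^esub> x)"
      using a b x smult_closed by (simp add: smult_eq smult_assoc)
  next
    fix a x y assume a: "a \<in> carrier R" and "x \<in> carrier L" "y \<in> carrier L"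
    then obtain x' y' where x: "x' \<in> carrier M" "x = \<phi> x'" and y: "y' \<in> carrier M" "y = \<phi> y'"
      using ex by blast
    show "a \<odot>\<^bsub>L\<^esub> (x \<oplus>\<^bsub>L\<^esub> y) = a \<odot>\<^bsub>L\<^esub> x \<oplus>\<^bsub>L\<^esub> a \<odot>\<^bsub>L\<^esub> y"
      using a x y smult_closed by (simp add: smult_eq add_eq smult_r_distr)
  next
    fix x assume "x \<in> carrier L"
    then obtain x' where x: "x' \<in> carrier M" "x = \<phi> x'" using ex by blast
    show "\<one>\<^bsub>R\<^esub> \<odot>\<^bsub>L\<^esub> x = x" using x by (simp add: smult_eq smult_one)
  qed
  ultimately have "left_module R L"
    using R.ring_axioms by (intro left_module.intro)
  then show ?thesis
    using assms unfolding left_module_iso_def by blast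
qed

lemma finsum_pointwise:
  fixes M :: "('r, 'v \<Rightarrow> 'z::comm_monoid_add, 'y) module_scheme"
  assumes "abelian_group M" "finite I" "g \<in> I \<rightarrow> carrier M"
    and zero_eq: "\<zero>\<^bsub>M\<^esub> = (\<lambda>_. 0)"
    and add_eq: "\<And>x y. x \<in> carrier M \<Longrightarrow> y \<in> carrier M \<Longrightarrow> x \<oplus>\<^bsub>M\<^esub> y = (\<lambda>v. x v + y v)"
  shows "finsum M g I = (\<lambda>v. \<Sum>i\<in>I. g i v)"
  using assms(2,3)
proof (induction I rule: finite_induct)
  interpret abelian_group M by fact
  case empty
  show ?case by (simp add: zero_eq)
next
  interpret abelian_group M by fact
  case (insert i I)
  have "finsum M g I \<in> carrier M" "g i \<in> carrier M"
    using insert.prems by (auto intro: finsum_closed)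
  then have "g i \<oplus>\<^bsub>M\<^esub> finsum M g I = (\<lambda>v. g i v + finsum M g I v)"
    by (intro add_eq)
  then show ?case
    using insert by (subst finsum_insert) auto
qed

text \<open>The indicator functions of the points \<open>r i\<close> form a basis, the coordinates
  of a family being its values at these points.\<close>

lemma cm_moduleI:
  fixes M :: "('r, 'v \<Rightarrow> complex fps, 'y) module_scheme" and r :: "nat \<Rightarrow> 'v"
  assumes M: "left_module R M"
    and r: "inj_on r {..<n}"
    and carrier: "carrier M = {x. \<forall>v. v \<notin> r ` {..<n} \<longrightarrow> x v = 0}"
    and zero_eq: "\<zero>\<^bsub>M\<^esub> = (\<lambda>_. 0)"
    and add_eq: "\<And>x y. x \<in> carrier M \<Longrightarrow> y \<in> carrier M \<Longrightarrow> x \<oplus>\<^bsub>M\<^esub> y = (\<lambda>v. x v + y v)"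
    and scalar: "\<And>f x. x \<in> carrier M \<Longrightarrow> \<zeta> f \<odot>\<^bsub>M\<^esub> x = (\<lambda>v. f * x v)"
  shows "cm_module R \<zeta> M"
proof -
  interpret left_module R M by fact
  define b :: "nat \<Rightarrow> 'v \<Rightarrow> complex fps" where "b = (\<lambda>i v. if v = r i then 1 else 0)"
  have b: "b \<in> {..<n} \<rightarrow> carrier M"
    by (auto simp: b_def carrier)
  have comb: "finsum M (\<lambda>i. \<zeta> (z i) \<odot>\<^bsub>M\<^esub> b i) {..<n} = (\<lambda>v. \<Sum>i<n. z i * b i v)" for z
  proof -
    have scaled: "\<zeta> (z i) \<odot>\<^bsub>M\<^esub> b i = (\<lambda>v. z i * b i v)" if "i < n" for i
      using scalar b that by auto
    then have "(\<lambda>i. \<zeta> (z i) \<odot>\<^bsub>M\<^esub> b i) \<in> {..<n} \<rightarrow> carrier M"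
      by (auto simp: b_def carrier)
    from finsum_pointwise[OF M.abelian_group_axioms _ this zero_eq add_eq]
    have "finsum M (\<lambda>i. \<zeta> (z i) \<odot>\<^bsub>M\<^esub> b i) {..<n} =
        (\<lambda>v. \<Sum>i<n. (\<zeta> (z i) \<odot>\<^bsub>M\<^esub> b i) v)"
      by simp
    then show ?thesis using scaled by simp
  qed
  have coord: "(\<Sum>i<n. z i * b i (r j)) = z j" if "j < n" for j z
  proof -
    have "(\<Sum>i<n. z i * b i (r j)) = (\<Sum>i<n. if i = j then z j else 0)"
      using that r by (intro sum.cong) (auto simp: b_def inj_on_def)
    then show ?thesis using that by simp
  qed
  have outside: "(\<Sum>i<n. z i * b i v) = 0" if "v \<notin> r ` {..<n}" for v z
    using that by (intro sum.neutral) (auto simp: b_def)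
  have expand: "x = (\<lambda>v. \<Sum>i<n. z i * b i v) \<longleftrightarrow> (\<forall>i<n. z i = x (r i))"
    if x: "x \<in> carrier M" for x z
  proof
    assume "x = (\<lambda>v. \<Sum>i<n. z i * b i v)"
    then show "\<forall>i<n. z i = x (r i)" using coord by metis
  next
    assume z: "\<forall>i<n. z i = x (r i)"
    show "x = (\<lambda>v. \<Sum>i<n. z i * b i v)"
    proof
      fix v
      show "x v = (\<Sum>i<n. z i * b i v)"
      proof (cases "v \<in> r ` {..<n}")
        case True
        then show ?thesis using coord[of _ z] z by auto
      next
        case False
        then show ?thesis using outside x by (simp add: carrier)
      qed
    qed
  qed
  have "\<exists>!z. z \<in> {..<n} \<rightarrow>\<^sub>E UNIV \<and> x = finsum M (\<lambda>i. \<zeta> (z i) \<odot>\<^bsub>M\<^esub> b i) {..<n}"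
    if x: "x \<in> carrier M" for x
    unfolding comb expand[OF x]
  proof (rule ex1I)
    show "(\<lambda>i\<in>{..<n}. x (r i)) \<in> {..<n} \<rightarrow>\<^sub>E UNIV \<and> (\<forall>i<n. (\<lambda>i\<in>{..<n}. x (r i)) i = x (r i))"
      by simp
    fix z assume "z \<in> {..<n} \<rightarrow>\<^sub>E UNIV \<and> (\<forall>i<n. z i = x (r i))"
    then have "z \<in> extensional {..<n}" "\<And>i. i \<in> {..<n} \<Longrightarrow> z i = (\<lambda>i\<in>{..<n}. x (r i)) i"
      by (auto simp: PiE_def)
    then show "z = (\<lambda>i\<in>{..<n}. x (r i))"
      by (intro extensionalityI[OF _ restrict_extensional])
  qed
  then show ?thesis
    unfolding cm_module_def using M b by (intro conjI exI[of _ n] exI[of _ b] ballI)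
qed

section \<open>The boundary algebra and the algebra C acting on a matching module\<close>

lemma dimer_quiver_sel [simp]:
  "verts (dimer_quiver D) = {R. alternating_region D R}"
  "arcs (dimer_quiver D) = dimer_arrows D"
  "tail (dimer_quiver D) = arrow_tail D"
  "head (dimer_quiver D) = arrow_head D"
  by (simp_all add: dimer_quiver_def)

lemma circle_quiver_sel [simp]:
  "verts (circle_quiver n) = {..<n}"
  "arcs (circle_quiver n) = ArrX ` {..<n} \<union> ArrY ` {..<n}"
  "tail (circle_quiver n) = circle_tail n"
  "head (circle_quiver n) = circle_head n"
  by (simp_all add: circle_quiver_def)

lemma interval_before_less: "i < n \<Longrightarrow> interval_before n i < n"
  by (simp add: interval_before_def)

lemma interval_before_inj:
  assumes "i < n" "j < n" "interval_before n i = interval_before n j"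
  shows "i = j"
proof -
  have "interval_before n i = (if i = 0 then n - 1 else i - 1)" if "i < n" for i
    using that by (auto simp: interval_before_def mod_if)
  then show ?thesis using assms by (auto split: if_splits)
qed

lemma heads_closed_circle: "heads_closed (circle_quiver n)"
  by (auto simp: heads_closed_def interval_before_less)

lemma circle_arrow_carrier:
  assumes "i < n"
  shows "arrow_elem (circle_quiver n) (ArrX i) \<in> carrier (path_algebra (circle_quiver n))"
    and "arrow_elem (circle_quiver n) (ArrY i) \<in> carrier (path_algebra (circle_quiver n))"
  unfolding arrow_elem_def using assms
  by (auto intro!: path_elem_carrier arc_in_paths simp: interval_before_less
      simp del: circle_quiver_sel(3)) (simp_all add: interval_before_less)

lemma circle_xy_carrier:
  "circle_x n \<in> carrier (path_algebra (circle_quiver n))"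
  "circle_y n \<in> carrier (path_algebra (circle_quiver n))"
  using path_carrierD[OF circle_arrow_carrier(1)] path_carrierD[OF circle_arrow_carrier(2)]
  by (auto simp: circle_x_def circle_y_def intro!: path_carrierI sum.neutral)

text \<open>Distinctness of the cycle turns the weight into the number of corners in the
  matching.\<close>

lemma weight_boundary_cycle:
  assumes "perfect_matching D \<mu>" "boundary_cycle D F as"
  shows "weight \<mu> as = 1"
proof -
  have "\<exists>!\<alpha>. \<alpha> \<in> corners D F \<and> \<alpha> \<in> \<mu>" "distinct as" "set as = corners D F"
    using assms by (auto simp: perfect_matching_def boundary_cycle_def)
  moreover from this obtain \<alpha> where "{a \<in> set as. a \<in> \<mu>} = {\<alpha>}" by auto
  ultimately show ?thesis
    using distinct_card[of "filter (\<lambda>a. a \<in> \<mu>) as"] by (simp add: weight_def)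
qed

text \<open>The bound on \<open>n\<close>, a consequence of \<open>1 \<le> k\<close> and
  \<open>k < n\<close>, makes the two intervals adjacent to a marked point different.\<close>

locale boundary_rep =
  fixes D :: diagram and k n :: nat and \<mu> :: "arrow set"
    and N :: "(dimer_elt, complex set \<Rightarrow> complex fps) module"
    and \<epsilon> :: "circle_elt \<Rightarrow> dimer_elt"
  assumes finite_crossings: "finite (crossings D)"
    and npts: "npts D = n" and n: "2 \<le> n"
    and matching: "perfect_matching D \<mu>"
    and N: "matching_module D \<mu> N"
    and canonical: "canonical_map D k \<epsilon>"
begin

abbreviation "Q \<equiv> dimer_quiver D"
abbreviation "P \<equiv> path_algebra Q"
abbreviation "A \<equiv> dimer_algebra D"
abbreviation "B \<equiv> boundary_algebra D"
abbreviation "e \<equiv> boundary_idempotent D"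
abbreviation "r \<equiv> interval_region D"
abbreviation "bvs \<equiv> interval_region D ` {..<n}"
abbreviation "CQ \<equiv> circle_quiver n"
abbreviation "C \<equiv> circle_algebra k n"
abbreviation "I \<equiv> boundary_value D \<mu>"
abbreviation "eN \<equiv> corner_module e N"
abbreviation "M \<equiv> restrict_scalars \<epsilon> eN"

lemma N_module: "left_module A N"
  and N_carrier: "carrier N = {x. \<forall>v. v \<notin> verts Q \<longrightarrow> x v = 0}"
  and N_zero: "\<zero>\<^bsub>N\<^esub> = (\<lambda>_. 0)"
  and N_add: "\<And>x y. x \<in> carrier N \<Longrightarrow> y \<in> carrier N \<Longrightarrow> x \<oplus>\<^bsub>N\<^esub> y = (\<lambda>v. x v + y v)"
  and N_scalar: "\<And>c x. x \<in> carrier N \<Longrightarrow>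
    dimer_class D (scalar_elem Q c) \<odot>\<^bsub>N\<^esub> x = (\<lambda>v. fps_const c * x v)"
  and N_vertex: "\<And>v x. v \<in> verts Q \<Longrightarrow> x \<in> carrier N \<Longrightarrow>
    dimer_class D (path_elem v []) \<odot>\<^bsub>N\<^esub> x = (\<lambda>w. if w = v then x v else 0)"
  and N_arrow: "\<And>\<alpha> x. \<alpha> \<in> arcs Q \<Longrightarrow> x \<in> carrier N \<Longrightarrow>
    dimer_class D (arrow_elem Q \<alpha>) \<odot>\<^bsub>N\<^esub> x =
      (\<lambda>w. if w = head Q \<alpha> then (if \<alpha> \<in> \<mu> then fps_X else 1) * x (tail Q \<alpha>) else 0)"
  using N unfolding matching_module_def Let_def by blast+

lemma \<epsilon>_hom: "\<epsilon> \<in> ring_hom C B"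
  and \<epsilon>_scalar: "\<And>c. \<epsilon> (circle_class k n (scalar_elem CQ c)) =
    dimer_class D (scalar_elem Q c) \<otimes>\<^bsub>A\<^esub> e"
  and \<epsilon>_vertex: "\<And>j. j < n \<Longrightarrow>
    \<epsilon> (circle_class k n (path_elem j [])) = dimer_class D (path_elem (r j) [])"
  using canonical unfolding canonical_map_def Let_def npts by blast+

lemma \<epsilon>_arrows:
  assumes "i < n"
  obtains F ps where "boundary_cycle D F (Boundary i # ps)"
    "\<epsilon> (circle_class k n (arrow_elem CQ (ArrX i))) =
      (if clockwise_arrow D i then dimer_class D (arrow_elem Q (Boundary i))
       else dimer_class D (path_elem (arrow_head D (Boundary i)) ps))"
    "\<epsilon> (circle_class k n (arrow_elem CQ (ArrY i))) =
      (if clockwise_arrow D i then dimer_class D (path_elem (arrow_head D (Boundary i)) ps)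
       else dimer_class D (arrow_elem Q (Boundary i)))"
  using canonical assms that unfolding canonical_map_def Let_def npts by blast

text \<open>The class of the trivial path at \<open>r j\<close> lies in \<open>e A e\<close> as an
  image under \<open>\<epsilon>\<close>, and products there have no coefficient on a trivial path at
  a non-vertex. The argument works with sets of representatives because \<open>A\<close> is not yet
  known to be a ring.\<close>

lemma region_in_verts:
  assumes "j < n"
  shows "r j \<in> verts Q"
proof (rule ccontr)
  assume nv: "r j \<notin> verts Q"
  have "(j, []) \<in> paths CQ"
    using assms by simp
  then have "circle_class k n (path_elem j []) \<in> carrier C"
    unfolding circle_algebra_def path_quotient_carrier circle_class_def
    by (intro imageI path_elem_carrier)
  then have "dimer_class D (path_elem (r j) []) \<in> carrier B"
    using ring_hom_closed[OF \<epsilon>_hom] \<epsilon>_vertex[OF assms] by metis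
  then obtain a where a: "a \<in> carrier A"
      and eq: "dimer_class D (path_elem (r j) []) = e \<otimes>\<^bsub>A\<^esub> a \<otimes>\<^bsub>A\<^esub> e"
    unfolding boundary_algebra_def corner_ring_carrier by blast
  have "path_elem (r j) [] \<in> e \<otimes>\<^bsub>A\<^esub> a \<otimes>\<^bsub>A\<^esub> e"
    unfolding eq[symmetric] dimer_class_def by (rule path_class_self)
  then have "(path_elem (r j) [] :: (complex set, arrow) path_elt) (r j, []) = 0"
    unfolding dimer_algebra_def
    by (rule path_quotient_mult_vertex[OF a[unfolded dimer_algebra_def] nv])
  then show False by (simp add: path_elem_def)
qed

text \<open>Otherwise the dimer algebra would vanish, and so would \<open>N\<close>.\<close>

lemma ring_P: "ring P"
proof (rule ccontr)
  assume P: "\<not> ring P"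
  interpret N: left_module A N by (rule N_module)
  let ?f = "path_elem (r 0) []" and ?x = "\<lambda>v. if v = r 0 then 1 else (0 :: complex fps)"
  have v: "r 0 \<in> verts Q" using region_in_verts n by simp
  then have x: "?x \<in> carrier N" by (auto simp: N_carrier)
  have "dimer_class D ?f = \<zero>\<^bsub>A\<^esub>"
    unfolding dimer_class_def dimer_algebra_def path_quotient_zero
      closed_ideal_degenerate[OF disjI1, OF P]
    using v by (intro path_class_degenerate[OF P] path_elem_carrier) simp
  then have "dimer_class D ?f \<odot>\<^bsub>N\<^esub> ?x = (\<lambda>_. 0)"
    using N.smult_zero_left[OF x] N_zero by simp
  with N_vertex[OF v x] have "(\<lambda>w. if w = r 0 then ?x (r 0) else 0) = (\<lambda>_. 0)"
    by (rule trans[OF sym])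
  from fun_cong[OF this, of "r 0"] show False by simp
qed

lemma heads_Q: "heads_closed Q"
  by (rule heads_closed_if_ring[OF ring_P])

section \<open>The dimer algebra acting on N\<close>

lemma class_hom: "dimer_class D \<in> ring_hom P A"
  unfolding dimer_class_def[abs_def] dimer_algebra_def by (rule path_class_hom[OF ring_P])

lemma class_carrier: "f \<in> carrier P \<Longrightarrow> dimer_class D f \<in> carrier A"
  by (rule ring_hom_closed[OF class_hom])

lemma class_mult: "f \<in> carrier P \<Longrightarrow> g \<in> carrier P \<Longrightarrow>
    dimer_class D (f \<otimes>\<^bsub>P\<^esub> g) = dimer_class D f \<otimes>\<^bsub>A\<^esub> dimer_class D g"
  by (rule ring_hom_mult[OF class_hom])

sublocale N: left_module A N
  by (rule N_module)

sublocale dimer: power_series_rep Q \<mu> "\<lambda>f x. dimer_class D f \<odot>\<^bsub>N\<^esub> x" "carrier N"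
proof
  show "finite (arcs Q)"
    using finite_crossings by (simp add: dimer_arrows_def)
  fix f g x assume f: "f \<in> carrier P" and g: "g \<in> carrier P" and x: "x \<in> carrier N"
  show "dimer_class D (\<lambda>\<pi>. f \<pi> + g \<pi>) \<odot>\<^bsub>N\<^esub> x =
      (\<lambda>v. (dimer_class D f \<odot>\<^bsub>N\<^esub> x) v + (dimer_class D g \<odot>\<^bsub>N\<^esub> x) v)"
    using ring_hom_add[OF class_hom f g] class_carrier f g x
    by (simp add: path_add N.smult_l_distr N_add N.smult_closed)
  show "dimer_class D (f \<otimes>\<^bsub>P\<^esub> g) \<odot>\<^bsub>N\<^esub> x = dimer_class D f \<odot>\<^bsub>N\<^esub> (dimer_class D g \<odot>\<^bsub>N\<^esub> x)"
    using class_carrier f g x by (simp add: class_mult N.smult_assoc)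
qed (use heads_Q N_carrier N_scalar N_vertex N_arrow class_carrier N.smult_closed in simp_all)

lemma idempotent_repr:
  defines "e0 \<equiv> (\<lambda>(u, p). if u \<in> bvs \<and> p = [] then 1 else 0)"
  shows "e = dimer_class D e0" "e0 \<in> carrier P" "e0 \<otimes>\<^bsub>P\<^esub> e0 = e0"
proof -
  show "e = dimer_class D e0"
    by (simp add: boundary_idempotent_def e0_def npts)
  show "e0 \<in> carrier P"
    using region_in_verts by (auto simp: path_carrier e0_def)
  show "e0 \<otimes>\<^bsub>P\<^esub> e0 = e0"
    unfolding e0_def vertex_mult_left by (auto simp: fun_eq_iff)
qed

lemma e_carrier: "e \<in> carrier A" and e_idem: "e \<otimes>\<^bsub>A\<^esub> e = e"
  using idempotent_repr class_carrier class_mult by metis+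

lemma e_smult:
  assumes x: "x \<in> carrier N"
  shows "e \<odot>\<^bsub>N\<^esub> x = (\<lambda>v. if v \<in> bvs then x v else 0)"
proof
  fix v
  define e0 :: "(complex set, arrow) path_elt"
    where "e0 = (\<lambda>(u, p). if u \<in> bvs \<and> p = [] then 1 else 0)"
  note e0 = idempotent_repr[folded e0_def]
  have ex: "e \<odot>\<^bsub>N\<^esub> x \<in> carrier N" using x e_carrier by (rule N.smult_closed[rotated])
  show "(e \<odot>\<^bsub>N\<^esub> x) v = (if v \<in> bvs then x v else 0)"
  proof (cases "v \<in> verts Q")
    case False
    then show ?thesis using ex region_in_verts by (auto simp: N_carrier)
  next
    case True
    \<comment> \<open>The action is prescribed on vertex idempotents, so each component of the
      result is read off by multiplying with the idempotent at \<open>v\<close>.\<close>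
    have "path_elem v [] \<otimes>\<^bsub>P\<^esub> e0 = (if v \<in> bvs then path_elem v [] else (\<lambda>_. 0))"
      unfolding path_elem_Nil vertex_mult_left by (auto simp: e0_def fun_eq_iff)
    moreover have "(e \<odot>\<^bsub>N\<^esub> x) v = (dimer_class D (path_elem v [] \<otimes>\<^bsub>P\<^esub> e0) \<odot>\<^bsub>N\<^esub> x) v"
      using dimer.act_mult[OF path_elem_carrier e0(2) x, of v "[]"] N_vertex[OF True ex] True e0(1)
      by simp
    ultimately show ?thesis
      using N_vertex[OF True x] dimer.act_zero[OF x] by simp
  qed
qed

lemma bvs_subset: "bvs \<subseteq> verts Q"
  using region_in_verts by blast

section \<open>The module e N and its restriction to C\<close>

lemma eN_carrier: "carrier eN = {x. \<forall>v. v \<notin> bvs \<longrightarrow> x v = 0}"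
proof (rule equalityI; rule subsetI)
  fix x :: "complex set \<Rightarrow> complex fps" assume "x \<in> carrier eN"
  then show "x \<in> {x. \<forall>v. v \<notin> bvs \<longrightarrow> x v = 0}"
    using e_smult by (auto simp: corner_module_carrier)
next
  fix x :: "complex set \<Rightarrow> complex fps" assume x: "x \<in> {x. \<forall>v. v \<notin> bvs \<longrightarrow> x v = 0}"
  then have "x \<in> carrier N" using bvs_subset unfolding N_carrier by blast
  moreover from this have "x = e \<odot>\<^bsub>N\<^esub> x" using x e_smult by (auto simp: fun_eq_iff)
  ultimately show "x \<in> carrier eN" unfolding corner_module_carrier by blast
qed

lemma eN_sub: "x \<in> carrier eN \<Longrightarrow> x \<in> carrier N"
  using bvs_subset unfolding N_carrier eN_carrier by blast

lemma eN_module: "left_module B eN"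
  unfolding boundary_algebra_def by (rule left_module_corner[OF N_module e_carrier e_idem])

lemma ring_C: "ring C"
  unfolding circle_algebra_def
  by (rule ring_path_quotient[OF ring_path_algebra[OF heads_closed_circle]])

lemma circle_class_hom: "circle_class k n \<in> ring_hom (path_algebra CQ) C"
  unfolding circle_class_def[abs_def] circle_algebra_def
  by (rule path_class_hom[OF ring_path_algebra[OF heads_closed_circle]])

lemma M_module: "left_module C M"
  by (rule left_module_restrict[OF eN_module ring_C \<epsilon>_hom])

sublocale M: left_module C M
  by (rule M_module)

lemma M_carrier: "carrier M = {x. \<forall>v. v \<notin> bvs \<longrightarrow> x v = 0}"
  by (simp add: restrict_scalars_carrier eN_carrier)

lemma M_smult: "c \<odot>\<^bsub>M\<^esub> x = \<epsilon> c \<odot>\<^bsub>N\<^esub> x"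
  by (simp add: restrict_scalars_smult corner_module_smult)

lemma M_add: "x \<in> carrier M \<Longrightarrow> y \<in> carrier M \<Longrightarrow> x \<oplus>\<^bsub>M\<^esub> y = (\<lambda>v. x v + y v)"
  using N_add eN_sub by (simp add: restrict_scalars_sel corner_module_add)

lemma M_zero: "\<zero>\<^bsub>M\<^esub> = (\<lambda>_. 0)"
  by (simp add: restrict_scalars_sel corner_module_zero N_zero)

lemma M_sub: "x \<in> carrier M \<Longrightarrow> x \<in> carrier N"
  using eN_sub by (simp add: restrict_scalars_carrier)

text \<open>The boundary regions are distinct because orthogonal idempotents of \<open>C\<close> have orthogonal
  images, whereas the idempotent of a vertex acts nontrivially on \<open>N\<close>.\<close>

lemma region_inj: "inj_on r {..<n}"
proof (rule inj_onI, rule ccontr)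
  fix i j assume "i \<in> {..<n}" "j \<in> {..<n}" and eq: "r i = r j" and ne: "i \<noteq> j"
  then have i: "i < n" and j: "j < n" by auto
  let ?x = "\<lambda>v. if v = r i then 1 else 0"
  have x: "?x \<in> carrier M" using i by (auto simp: M_carrier)
  have carr: "path_elem j [] \<in> carrier (path_algebra CQ)" if "j < n" for j
    using that by (intro path_elem_carrier) simp
  have "path_elem i [] \<otimes>\<^bsub>path_algebra CQ\<^esub> path_elem j [] = \<zero>\<^bsub>path_algebra CQ\<^esub>"
    unfolding path_elem_Nil vertex_mult_left using ne by (auto simp: path_zero fun_eq_iff)
  then have "circle_class k n (path_elem i []) \<otimes>\<^bsub>C\<^esub> circle_class k n (path_elem j []) = \<zero>\<^bsub>C\<^esub>"
    using ring_hom_mult[OF circle_class_hom carr[OF i] carr[OF j]]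
      ring_hom_zero[OF circle_class_hom ring_path_algebra[OF heads_closed_circle] ring_C] by simp
  then have "circle_class k n (path_elem i []) \<odot>\<^bsub>M\<^esub> (circle_class k n (path_elem j []) \<odot>\<^bsub>M\<^esub> ?x) = \<zero>\<^bsub>M\<^esub>"
    using M.smult_assoc[OF ring_hom_closed[OF circle_class_hom carr[OF i]]
        ring_hom_closed[OF circle_class_hom carr[OF j]] x] M.smult_zero_left[OF x] by simp
  \<comment> \<open>With \<open>r i = r j\<close>, both idempotents project to the same component
    and fix \<open>?x\<close>.\<close>
  then have "(\<lambda>w. if w = r i then 1 else 0 :: complex fps) = (\<lambda>_. 0)"
    using N_vertex[OF region_in_verts[OF i] M_sub[OF x]]
    by (simp add: M_smult M_zero \<epsilon>_vertex i j eq[symmetric] cong: if_cong)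
  from fun_cong[OF this, of "r i"] show False by simp
qed

lemma cycle_walk:
  assumes "boundary_cycle D F (a # ps)"
  shows "a \<in> arcs Q" "arrow_tail D a \<in> verts Q"
    "pre_digraph.awalk Q (arrow_head D a) ps (arrow_tail D a)"
  using assms awalk_Cons[OF heads_Q, of _ a ps] by (auto simp: boundary_cycle_def)

text \<open>The face cycle has weight one, so exactly one of the boundary arrow and its completion
  acts as t, and the other as the identity. Which of them is the image of \<open>ArrX i\<close>
  depends on the colour of the face; the definition of \<open>boundary_value\<close> absorbs the
  four cases.\<close>

lemma \<epsilon>_arrow_smult:
  assumes i: "i < n" and x: "x \<in> carrier N"
  shows "\<epsilon> (circle_class k n (arrow_elem CQ (ArrX i))) \<odot>\<^bsub>N\<^esub> x =
      (\<lambda>w. if w = r i then (if i \<in> I then fps_X else 1) * x (r (interval_before n i)) else 0)"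
    and "\<epsilon> (circle_class k n (arrow_elem CQ (ArrY i))) \<odot>\<^bsub>N\<^esub> x =
      (\<lambda>w. if w = r (interval_before n i) then (if i \<in> I then 1 else fps_X) * x (r i) else 0)"
proof -
  obtain F ps where F: "boundary_cycle D F (Boundary i # ps)"
    and X: "\<epsilon> (circle_class k n (arrow_elem CQ (ArrX i))) =
      (if clockwise_arrow D i then dimer_class D (arrow_elem Q (Boundary i))
       else dimer_class D (path_elem (arrow_head D (Boundary i)) ps))"
    and Y: "\<epsilon> (circle_class k n (arrow_elem CQ (ArrY i))) =
      (if clockwise_arrow D i then dimer_class D (path_elem (arrow_head D (Boundary i)) ps)
       else dimer_class D (arrow_elem Q (Boundary i)))"
    by (rule \<epsilon>_arrows[OF i])
  have weight: "weight \<mu> ps = (if Boundary i \<in> \<mu> then 0 else 1)"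
    using weight_boundary_cycle[OF matching F] by (simp split: if_splits)
  have I: "i \<in> I \<longleftrightarrow> (clockwise_arrow D i \<longleftrightarrow> Boundary i \<in> \<mu>)"
    using i by (simp add: boundary_value_def npts)
  note walk = cycle_walk[OF F]
  have "dimer_class D (arrow_elem Q (Boundary i)) \<odot>\<^bsub>N\<^esub> x = (\<lambda>w. if w = arrow_head D (Boundary i)
      then (if Boundary i \<in> \<mu> then fps_X else 1) * x (arrow_tail D (Boundary i)) else 0)"
    unfolding N_arrow[OF walk(1) x] by (simp cong: if_cong)
  moreover have "dimer_class D (path_elem (arrow_head D (Boundary i)) ps) \<odot>\<^bsub>N\<^esub> x =
      (\<lambda>w. if w = arrow_tail D (Boundary i)
        then (if Boundary i \<in> \<mu> then 1 else fps_X) * x (arrow_head D (Boundary i)) else 0)"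
    using dimer.act_path[OF walk(3) x] weight by (auto simp: fun_eq_iff)
  ultimately show
    "\<epsilon> (circle_class k n (arrow_elem CQ (ArrX i))) \<odot>\<^bsub>N\<^esub> x =
      (\<lambda>w. if w = r i then (if i \<in> I then fps_X else 1) * x (r (interval_before n i)) else 0)"
    "\<epsilon> (circle_class k n (arrow_elem CQ (ArrY i))) \<odot>\<^bsub>N\<^esub> x =
      (\<lambda>w. if w = r (interval_before n i) then (if i \<in> I then 1 else fps_X) * x (r i) else 0)"
    unfolding X Y I
    by (cases "clockwise_arrow D i"; cases "Boundary i \<in> \<mu>"; simp add: npts cong: if_cong)+
qed

section \<open>Comparison with the module of the boundary value\<close>

text \<open>The inverse of \<open>bc\<close> on \<open>e N\<close>, used to carry the C-action over
  to families indexed by boundary intervals.\<close>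

definition extend :: "(nat \<Rightarrow> complex fps) \<Rightarrow> complex set \<Rightarrow> complex fps" where
  "extend y = (\<lambda>v. if v \<in> bvs then y (the_inv_into {..<n} r v) else 0)"

abbreviation "bc \<equiv> boundary_components D"
abbreviation "L \<equiv> {y. \<forall>v. v \<notin> verts CQ \<longrightarrow> y v = (0 :: complex fps)}"

lemma bc_eq: "bc x = (\<lambda>j. if j < n then x (r j) else 0)"
  by (simp add: boundary_components_def npts)

lemma extend_region: "j < n \<Longrightarrow> extend y (r j) = y j"
  by (simp add: extend_def the_inv_into_f_f[OF region_inj])

lemma extend_carrier: "extend y \<in> carrier M"
  by (simp add: extend_def M_carrier)

lemma bc_carrier: "bc x \<in> L"
  by (simp add: bc_eq)

lemma bc_extend: "y \<in> L \<Longrightarrow> bc (extend y) = y"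
  by (auto simp: bc_eq extend_region fun_eq_iff)

lemma extend_bc: "x \<in> carrier M \<Longrightarrow> extend (bc x) = x"
proof
  fix v assume "x \<in> carrier M"
  then show "extend (bc x) v = x v"
    by (cases "v \<in> bvs") (auto simp: M_carrier extend_region bc_eq, simp add: extend_def)
qed

lemma bc_eqI: "x \<in> carrier M \<Longrightarrow> y \<in> carrier M \<Longrightarrow> bc x = bc y \<Longrightarrow> x = y"
  using extend_bc by metis

text \<open>This is the set in the definition of \<open>subset_module n I\<close>; naming it lets
  the two weighted actions be matched.\<close>

definition "weighted_arrows = ArrX ` ({..<n} \<inter> I) \<union> ArrY ` ({..<n} - I)"

text \<open>The module \<open>M\<close> conjugated by \<open>bc\<close> and \<open>extend\<close>.
  The path algebra of the circle acts through C and \<open>\<epsilon>\<close>, so the axiom on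
  arrows comes down to \<open>\<epsilon>_arrow_smult\<close>.\<close>

sublocale circle: power_series_rep CQ weighted_arrows "\<lambda>f y. bc (circle_class k n f \<odot>\<^bsub>M\<^esub> extend y)" L
proof
  show "heads_closed CQ" by (rule heads_closed_circle)
  show "finite (arcs CQ)" by simp
  have class_carrier: "circle_class k n f \<in> carrier C" if "f \<in> carrier (path_algebra CQ)" for f
    using ring_hom_closed[OF circle_class_hom that] .
  fix x assume x: "x \<in> L"
  show "bc (circle_class k n f \<odot>\<^bsub>M\<^esub> extend x) \<in> L" for f
    by (rule bc_carrier)
  show "bc (circle_class k n (scalar_elem CQ c) \<odot>\<^bsub>M\<^esub> extend x) = (\<lambda>v. fps_const c * x v)" for c
  proof -
    have ext: "extend x \<in> carrier N" "e \<odot>\<^bsub>N\<^esub> extend x = extend x"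
      using M_sub extend_carrier e_smult by (auto simp: fun_eq_iff extend_def)
    have "circle_class k n (scalar_elem CQ c) \<odot>\<^bsub>M\<^esub> extend x =
        (dimer_class D (scalar_elem Q c) \<otimes>\<^bsub>A\<^esub> e) \<odot>\<^bsub>N\<^esub> extend x"
      by (simp add: M_smult \<epsilon>_scalar)
    also have "\<dots> = dimer_class D (scalar_elem Q c) \<odot>\<^bsub>N\<^esub> (e \<odot>\<^bsub>N\<^esub> extend x)"
      by (intro N.smult_assoc e_carrier ext class_hom[THEN ring_hom_closed] scalar_elem_carrier)
    also have "\<dots> = (\<lambda>v. fps_const c * extend x v)"
      using ext N_scalar by simp
    finally show ?thesis using x by (auto simp: bc_eq extend_region fun_eq_iff)
  qed
  show "bc (circle_class k n (path_elem v []) \<odot>\<^bsub>M\<^esub> extend x) = (\<lambda>w. if w = v then x v else 0)"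
    if "v \<in> verts CQ" for v
    using that N_vertex[OF region_in_verts[of v] M_sub[OF extend_carrier[of x]]] region_inj
    by (auto simp: M_smult \<epsilon>_vertex bc_eq extend_region fun_eq_iff inj_on_def)
  show "bc (circle_class k n (arrow_elem CQ a) \<odot>\<^bsub>M\<^esub> extend x) =
      (\<lambda>w. if w = head CQ a then (if a \<in> weighted_arrows then fps_X else 1) * x (tail CQ a) else 0)"
    if "a \<in> arcs CQ" for a
    using that \<epsilon>_arrow_smult[OF _ M_sub[OF extend_carrier[of x]]] region_inj
    by (auto simp: M_smult bc_eq extend_region fun_eq_iff inj_on_def interval_before_less weighted_arrows_def)
  fix f g assume f: "f \<in> carrier (path_algebra CQ)" and g: "g \<in> carrier (path_algebra CQ)"
  show "bc (circle_class k n (\<lambda>\<pi>. f \<pi> + g \<pi>) \<odot>\<^bsub>M\<^esub> extend x) =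
      (\<lambda>v. bc (circle_class k n f \<odot>\<^bsub>M\<^esub> extend x) v + bc (circle_class k n g \<odot>\<^bsub>M\<^esub> extend x) v)"
  proof -
    have "circle_class k n (\<lambda>\<pi>. f \<pi> + g \<pi>) \<odot>\<^bsub>M\<^esub> extend x =
        circle_class k n f \<odot>\<^bsub>M\<^esub> extend x \<oplus>\<^bsub>M\<^esub> circle_class k n g \<odot>\<^bsub>M\<^esub> extend x"
      using ring_hom_add[OF circle_class_hom f g] M.smult_l_distr[OF class_carrier[OF f]
        class_carrier[OF g] extend_carrier] by (simp add: path_add)
    also have "\<dots> = (\<lambda>v. (circle_class k n f \<odot>\<^bsub>M\<^esub> extend x) v + (circle_class k n g \<odot>\<^bsub>M\<^esub> extend x) v)"
      by (intro M_add M.smult_closed class_carrier f g extend_carrier)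
    finally show ?thesis by (auto simp: bc_eq fun_eq_iff)
  qed
  show "bc (circle_class k n (f \<otimes>\<^bsub>path_algebra CQ\<^esub> g) \<odot>\<^bsub>M\<^esub> extend x) =
      bc (circle_class k n f \<odot>\<^bsub>M\<^esub> extend (bc (circle_class k n g \<odot>\<^bsub>M\<^esub> extend x)))"
    unfolding extend_bc[OF M.smult_closed[OF class_carrier[OF g] extend_carrier]]
      ring_hom_mult[OF circle_class_hom f g]
    by (simp only: M.smult_assoc[OF class_carrier[OF f] class_carrier[OF g] extend_carrier])
qed simp

text \<open>Scalar multiplication in \<open>subset_module\<close> is \<open>the_elem\<close> of the
  set of actions of all representatives. Each representative acts as the class does on
  \<open>M\<close>, so this set is a singleton.\<close>

lemma subset_module_smult:
  assumes c: "c \<in> carrier C" and x: "x \<in> carrier M"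
  shows "bc (c \<odot>\<^bsub>M\<^esub> x) = c \<odot>\<^bsub>subset_module n I\<^esub> bc x"
proof -
  have "weight_action CQ weighted_arrows f (bc x) = bc (c \<odot>\<^bsub>M\<^esub> x)" if "f \<in> c" for f
  proof -
    have "f \<in> carrier (path_algebra CQ)" "c = circle_class k n f"
      using path_class_memD[OF ring_path_algebra[OF heads_closed_circle] _ that] c
      unfolding circle_algebra_def circle_class_def by blast+
    then show ?thesis
      using circle.act_eq_weight_action[OF _ bc_carrier] extend_bc[OF x] by metis
  qed
  moreover have "c \<noteq> {}"
    using c path_class_self unfolding circle_algebra_def path_quotient_carrier by blast
  ultimately have "(\<lambda>f. weight_action CQ weighted_arrows f (bc x)) ` c = {bc (c \<odot>\<^bsub>M\<^esub> x)}"
    by auto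
  then show ?thesis
    by (simp add: subset_module_def weighted_arrows_def[symmetric])
qed

lemma restriction_iso: "left_module_iso C M (subset_module n I) bc"
proof (rule left_module_isoI[OF M_module])
  have "carrier (subset_module n I) = L"
    by (auto simp: subset_module_def)
  then show "bij_betw bc (carrier M) (carrier (subset_module n I))"
    using bc_extend extend_bc bc_carrier extend_carrier
    by (intro bij_betw_byWitness[where f' = extend]) auto
  show "bc \<zero>\<^bsub>M\<^esub> = \<zero>\<^bsub>subset_module n I\<^esub>"
    by (simp add: M_zero bc_eq subset_module_def)
  show "bc (x \<oplus>\<^bsub>M\<^esub> y) = bc x \<oplus>\<^bsub>subset_module n I\<^esub> bc y"
    if "x \<in> carrier M" "y \<in> carrier M" for x y
    using that by (auto simp: M_add bc_eq subset_module_def fun_eq_iff)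
qed (rule subset_module_smult)

section \<open>Freeness over power series\<close>

text \<open>At each marked point one of x and y acts as t and the other as 1, so their product acts
  as t on every component; power series in it follow by \<open>act_power_series\<close>.\<close>

lemma circle_scalar_smult:
  assumes x: "x \<in> carrier M"
  shows "circle_scalar k n f \<odot>\<^bsub>M\<^esub> x = (\<lambda>v. f * x v)"
proof -
  let ?PC = "path_algebra CQ"
  let ?T = "circle_x n \<otimes>\<^bsub>?PC\<^esub> circle_y n"
  note PC = ring_path_algebra[OF heads_closed_circle, of n]
  have T: "?T \<in> carrier ?PC" "?T (u, []) = 0" for u
    by (auto intro: path_mult_closed circle_xy_carrier)
      (simp add: path_mult circle_x_def arrow_elem_def path_elem_def)
  \<comment> \<open>Among the summands of x only \<open>ArrX j\<close> ends at interval
    \<open>j\<close>; likewise below only \<open>ArrY j\<close> ends at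
    \<open>interval_before n j\<close>, by \<open>interval_before_inj\<close>.\<close>
  have act_x: "bc (circle_class k n (circle_x n) \<odot>\<^bsub>M\<^esub> extend y) j =
      (if j \<in> I then fps_X else 1) * y (interval_before n j)" if "y \<in> L" "j < n" for y j
  proof -
    have "bc (circle_class k n (circle_x n) \<odot>\<^bsub>M\<^esub> extend y) =
        (\<lambda>v. \<Sum>i<n. bc (circle_class k n (arrow_elem CQ (ArrX i)) \<odot>\<^bsub>M\<^esub> extend y) v)"
      unfolding circle_x_def
      by (rule circle.act_sum) (use that circle_arrow_carrier in auto)
    then have "bc (circle_class k n (circle_x n) \<odot>\<^bsub>M\<^esub> extend y) j =
        (\<Sum>i<n. bc (circle_class k n (arrow_elem CQ (ArrX i)) \<odot>\<^bsub>M\<^esub> extend y) j)"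
      by (rule fun_cong)
    also have "\<dots> = (\<Sum>i<n. if i = j then (if j \<in> I then fps_X else 1) * y (interval_before n j) else 0)"
      using circle.act_arrow[OF _ _ that(1)]
      by (intro sum.cong) (auto simp: interval_before_less weighted_arrows_def)
    finally show ?thesis using that by simp
  qed
  have act_y: "bc (circle_class k n (circle_y n) \<odot>\<^bsub>M\<^esub> extend y) (interval_before n j) =
      (if j \<in> I then 1 else fps_X) * y j" if "y \<in> L" "j < n" for y j
  proof -
    have "bc (circle_class k n (circle_y n) \<odot>\<^bsub>M\<^esub> extend y) =
        (\<lambda>v. \<Sum>i<n. bc (circle_class k n (arrow_elem CQ (ArrY i)) \<odot>\<^bsub>M\<^esub> extend y) v)"
      unfolding circle_y_def
      by (rule circle.act_sum) (use that circle_arrow_carrier in auto)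
    then have "bc (circle_class k n (circle_y n) \<odot>\<^bsub>M\<^esub> extend y) (interval_before n j) =
        (\<Sum>i<n. bc (circle_class k n (arrow_elem CQ (ArrY i)) \<odot>\<^bsub>M\<^esub> extend y) (interval_before n j))"
      by (rule fun_cong)
    also have "\<dots> = (\<Sum>i<n. if i = j then (if j \<in> I then 1 else fps_X) * y j else 0)"
      using circle.act_arrow[OF _ _ that(1)] interval_before_inj that(2)
      by (intro sum.cong) (auto simp: weighted_arrows_def)
    finally show ?thesis using that by simp
  qed
  have act_T: "bc (circle_class k n ?T \<odot>\<^bsub>M\<^esub> extend y) j = fps_X * y j" if "y \<in> L" "j < n" for y j
    unfolding circle.act_mult[OF circle_xy_carrier that(1)]
    using act_x[OF bc_carrier that(2)] act_y[OF that] by simp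
  have carr: "circle_scalar k n f \<in> carrier C"
    unfolding circle_scalar_def
    by (rule ring_hom_closed[OF circle_class_hom power_series_elem_carrier[OF PC T(1)]])
  show ?thesis
  proof (rule bc_eqI)
    show "circle_scalar k n f \<odot>\<^bsub>M\<^esub> x \<in> carrier M" using M.smult_closed[OF carr x] .
    show "(\<lambda>v. f * x v) \<in> carrier M" using x by (simp add: M_carrier)
    have "bc (circle_scalar k n f \<odot>\<^bsub>M\<^esub> x) j = f * bc x j" if "j < n" for j
      using circle.act_power_series[OF T act_T[OF _ that] bc_carrier, of f x] extend_bc[OF x]
      by (simp add: circle_scalar_def)
    then show "bc (circle_scalar k n f \<odot>\<^bsub>M\<^esub> x) = bc (\<lambda>v. f * x v)"
      by (auto simp: bc_eq fun_eq_iff)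
  qed
qed

text \<open>\<open>dimer_t\<close> selects its cycles by \<open>SOME\<close>, so existence must be
  shown at boundary vertices. The boundary arrow \<open>j\<close> ends at \<open>r j\<close> if it
  is clockwise, and its cycle is then rotated by one arrow; otherwise it starts there.\<close>

lemma face_cycle_exists:
  assumes "j < n"
  shows "\<exists>as. face_cycle_at D (r j) as"
proof -
  obtain F ps where F: "boundary_cycle D F (Boundary j # ps)"
    by (rule \<epsilon>_arrows[OF assms])
  show ?thesis
  proof (cases "clockwise_arrow D j")
    case False
    then show ?thesis
      using F unfolding face_cycle_at_def by (intro exI[of _ "Boundary j # ps"]) auto
  next
    case True
    let ?as = "Boundary j # ps" and ?bs = "ps @ [Boundary j]"
    note walk = cycle_walk[OF F]
    \<comment> \<open>Otherwise the boundary arrow would be a loop and the intervals on both sides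
      of marked point \<open>j\<close> would coincide.\<close>
    have "ps \<noteq> []"
    proof
      assume "ps = []"
      then have "r j = r (interval_before n j)"
        using walk(3) True by (simp add: pre_digraph.awalk_def pre_digraph.cas.simps npts)
      then have "interval_before n j = j"
        using region_inj assms interval_before_less[OF assms] by (auto simp: inj_on_def)
      then show False using assms n by (auto simp: interval_before_def mod_if split: if_splits)
    qed
    then have hd: "arrow_tail D (hd ?bs) = arrow_head D (Boundary j)"
      using walk(3) by (cases ps) (auto simp: awalk_Cons[OF heads_Q])
    have "arrow_head D (Boundary j) \<in> verts Q"
      using walk(3) by (simp add: pre_digraph.awalk_def)
    then have "pre_digraph.awalk Q (arrow_head D (Boundary j)) ?bs (arrow_head D (Boundary j))"
      using walk unfolding awalk_append[OF heads_Q] awalk_Cons[OF heads_Q]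
      by (auto simp: pre_digraph.awalk_def pre_digraph.cas.simps)
    moreover have "next_corner D F (?bs ! m) (?bs ! (Suc m mod length ?bs))"
      if "m < length ?bs" for m
    proof -
      \<comment> \<open>Rotation shifts indices by one modulo the length, so successive corners
        remain successive.\<close>
      have bs: "?bs ! m = ?as ! (Suc m mod length ?as)" if "m < length ?bs" for m
        using that by (auto simp: nth_append mod_if)
      have "?bs ! (Suc m mod length ?bs) = ?as ! (Suc (Suc m mod length ?as) mod length ?as)"
        using bs[of "Suc m mod length ?bs"] by simp
      then show ?thesis
        using F bs[OF that] unfolding boundary_cycle_def by simp
    qed
    ultimately have "boundary_cycle D F ?bs"
      using F hd unfolding boundary_cycle_def by auto
    then show ?thesis
      using hd True unfolding face_cycle_at_def by auto
  qed
qed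

lemma face_cycle_walk: "face_cycle_at D v as \<Longrightarrow> pre_digraph.awalk Q v as v"
  by (auto simp: face_cycle_at_def boundary_cycle_def)

lemma dimer_t_carrier: "dimer_t D \<in> carrier P"
  using face_cycle_walk by (auto simp: path_carrier dimer_t_def paths_def)

lemma dimer_t_smult:
  assumes j: "j < n" and x: "x \<in> carrier N"
  shows "(dimer_class D (dimer_t D) \<odot>\<^bsub>N\<^esub> x) (r j) = fps_X * x (r j)"
proof -
  define c where "c = (SOME as. face_cycle_at D (r j) as)"
  have c: "face_cycle_at D (r j) c"
    unfolding c_def using face_cycle_exists[OF j] by (rule someI_ex)
  have rj: "r j \<in> verts Q" by (rule region_in_verts[OF j])
  \<comment> \<open>Face cycles are closed, so among the summands of \<open>dimer_t\<close> the one
    ending at \<open>r j\<close> is the one chosen there.\<close>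
  have "path_elem (r j) [] \<otimes>\<^bsub>P\<^esub> dimer_t D = path_elem (r j) c"
  proof (rule ext, clarify)
    fix u p
    have last: "pre_digraph.awlast Q v as = v" if "face_cycle_at D v as" for v as
      using face_cycle_walk[OF that] by (simp add: awalk_iff_paths)
    show "(path_elem (r j) [] \<otimes>\<^bsub>P\<^esub> dimer_t D) (u, p) = path_elem (r j) c (u, p)"
      unfolding path_elem_Nil vertex_mult_left
      using last[OF c] last[of u p] c by (auto simp: dimer_t_def path_elem_def c_def)
  qed
  moreover have "(dimer_class D (dimer_t D) \<odot>\<^bsub>N\<^esub> x) (r j) =
      (dimer_class D (path_elem (r j) [] \<otimes>\<^bsub>P\<^esub> dimer_t D) \<odot>\<^bsub>N\<^esub> x) (r j)"
    using dimer.act_mult[OF path_elem_carrier dimer_t_carrier x, of "r j" "[]"] rj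
      N_vertex[OF rj dimer.act_closed[OF dimer_t_carrier x]] by simp
  moreover have "weight \<mu> c = 1"
    using c weight_boundary_cycle[OF matching] by (auto simp: face_cycle_at_def)
  ultimately show ?thesis
    using dimer.act_path[OF face_cycle_walk[OF c] x] by simp
qed

lemma boundary_scalar_smult:
  assumes x: "x \<in> carrier eN"
  shows "boundary_scalar D f \<odot>\<^bsub>eN\<^esub> x = (\<lambda>v. f * x v)"
proof -
  let ?p = "power_series_elem Q (dimer_t D) f"
  have p: "?p \<in> carrier P" by (rule power_series_elem_carrier[OF ring_P dimer_t_carrier])
  have t0: "dimer_t D (u, []) = 0" for u
    by (simp add: dimer_t_def face_cycle_at_def boundary_cycle_def)
  have xN: "x \<in> carrier N" using eN_sub[OF x] .
  have "boundary_scalar D f \<odot>\<^bsub>eN\<^esub> x = e \<odot>\<^bsub>N\<^esub> (dimer_class D ?p \<odot>\<^bsub>N\<^esub> x)"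
    using N.smult_assoc[OF e_carrier class_carrier[OF p] xN]
    by (simp add: corner_module_smult boundary_scalar_def)
  \<comment> \<open>Applying \<open>e\<close> last discards the components off the boundary, where
    the action of \<open>dimer_t\<close> has not been determined.\<close>
  also have "\<dots> = (\<lambda>v. if v \<in> bvs then (dimer_class D ?p \<odot>\<^bsub>N\<^esub> x) v else 0)"
    by (rule e_smult[OF dimer.act_closed[OF p xN]])
  also have "\<dots> = (\<lambda>v. f * x v)"
    using dimer.act_power_series[OF dimer_t_carrier t0 dimer_t_smult xN] x
    by (auto simp: eN_carrier fun_eq_iff)
  finally show ?thesis .
qed

lemma cm_eN: "cm_module B (boundary_scalar D) eN"
  using N_add eN_sub
  by (intro cm_moduleI[OF eN_module region_inj eN_carrier _ _ boundary_scalar_smult])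
    (simp_all add: corner_module_zero corner_module_add N_zero)

lemma cm_M: "cm_module C (circle_scalar k n) M"
  by (rule cm_moduleI[OF M_module region_inj M_carrier M_zero M_add circle_scalar_smult])

end

theorem proposition4p9:
  fixes D :: diagram and k n :: nat and \<mu> :: "arrow set"
    and N :: "(dimer_elt, complex set \<Rightarrow> complex fps) module"
    and \<epsilon> :: "circle_elt \<Rightarrow> dimer_elt"
  assumes "postnikov_diagram D" and "connected_diagram D"
    and "has_type D k n" and "1 \<le> k" and "k < n"
    and "perfect_matching D \<mu>" and "matching_module D \<mu> N"
    and "canonical_map D k \<epsilon>"
  shows "cm_module (boundary_algebra D) (boundary_scalar D)
           (corner_module (boundary_idempotent D) N)
       \<and> cm_module (circle_algebra k n) (circle_scalar k n)
           (restrict_scalars \<epsilon> (corner_module (boundary_idempotent D) N))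
       \<and> left_module_iso (circle_algebra k n)
           (restrict_scalars \<epsilon> (corner_module (boundary_idempotent D) N))
           (subset_module n (boundary_value D \<mu>))
           (boundary_components D)"
proof -
  interpret boundary_rep D k n \<mu> N \<epsilon>
    using assms by unfold_locales (auto simp: postnikov_diagram_def Let_def has_type_def)
  show ?thesis using cm_eN cm_M restriction_iso by blast
qed

end
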